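(* Let $X=(x,x_{n+1})$, $x_{n+1}=\sqrt{1-|x|^2}$, $|x|<1$, be the canonical parametrization of the upper hemisphere and regard $\rho$ as a $C^2$ function of $x$. Suppose $\Gamma=\{\rho(x)X : X\in\mathscr U\}$ is a solution of the near field refractor problem (as in the context) satisfying the conditions: $y_{n+1}>0$; $\psi^{n+1}>0$; $\nabla\psi(Z(x))\cdot Y(x)>0$; $\operatorname{dist}(\mathscr U,\mathscr V)>0$. Then $\rho$ solves $$\det(\mathcal M)\,\det\left(D^2\rho+\frac1{bt}\mathcal A+\frac1b\mathcal B\right)=\frac fg\,\frac{y_{n+1}}{x_{n+1}}\,\frac{\nabla\psi\cdot Y}{|\nabla\psi|}\,\frac1{t^n},$$ where $b=\dfrac{\kappa\rho-\sqrt{\rho^2+(1-\kappa^2)(|\nabla\rho|^2-(\nabla\rho\cdot x)^2)}}{\rho^2+|\nabla\rho|^2-(\nabla\rho\cdot x)^2}$, $\kappa=n_1/n_2$, and $\mathcal M,\mathcal A,\mathcal B$ are the matrices given in the context. Moreover, the matrix $\mathcal M$ is invertible in some small neighborhood of $x=0$.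
   Context: Setting. $n\ge2$; $\mathbb S^n_+=\{X=(x,x_{n+1})\in\mathbb R^{n+1}:|X|=1,\ x_{n+1}>0\}$ with $x\in\mathbb R^n$. $\mathscr U\subset\mathbb S^n_+$ is open; $\Sigma=\{\psi=0\}\subset\mathbb R^{n+1}$ is a regular hypersurface, $\psi$ smooth; $\mathscr V$ is an open subset of $\Sigma$. $\nabla\psi=(\psi^1,\dots,\psi^{n+1})=(\widehat\nabla\psi,\psi^{n+1})$ with $\psi^k=\partial\psi/\partial z_k$, evaluated at $Z(x)$. $f\in L^1(\mathscr U)$, $g\in L^1(\mathscr V)$ are positive smooth functions with $\int_{\mathscr U}f\,d\sigma=\int_{\mathscr V}g\,d\sigma$ ($d\sigma$ = surface measure on $\mathbb S^n$, resp. $\Sigma$); $f$ is evaluated at $X$ and $g$ at $Z(x)$. $\rho>0$, and $\Gamma$ separates two homogeneous media with refractive indices $n_1$ (containing the origin) and $n_2$; $\kappa=n_1/n_2\neq1$ ($n_1$ may be smaller or larger than $n_2$). Refraction. $\nabla\rho$, $D^2\rho$ are derivatives in $x\in\mathbb R^n$. The unit normal to $\Gamma$ at $\rho(x)X$ toward medium $n_2$ is $\nu=-\frac{(\nabla\rho,0)-X(\rho+x\cdot\nabla\rho)}{\sqrt{\rho^2+|\nabla\rho|^2-(x\cdot\nabla\rho)^2}}$. A ray from the origin in direction $X$ is refracted at $\rho(x)X$ into the unit direction $Y(x)=(y,y_{n+1})$, $y\in\mathbb R^n$, given by Snell's law $X-\frac1\kappa Y=\lambda\nu$, $\lambda=X\cdot\nu-\frac1\kappa\sqrt{1-\kappa^2(1-(X\cdot\nu)^2)}$.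 The refracted ray hits $\Sigma$ at $Z(x)=\rho(x)X+t(x)Y(x)$, where $t(x)=|Z(x)-\rho(x)X|$ (the stretch function). $\Gamma$ solves the near field refractor problem if $Z(x)\in\mathscr V$ for all $X\in\mathscr U$ and $\int_Ef\,d\sigma=\int_{\mathcal R(E)}g\,d\sigma$ for all Borel $E\subset\mathscr U$, where $\mathcal R(E)=\{Z(x):(x,x_{n+1})\in E\}$. Notation. Vectors are columns, $\xi\otimes\eta=\xi\eta^t$, $\mathrm{Id}$ is the $n\times n$ identity. $a=\rho^2+|\nabla\rho|^2-(\nabla\rho\cdot x)^2$, $q=\sqrt{a-\kappa^2(a-\rho^2)}$ (so $b=\frac{\kappa\rho-q}{a}$), $\alpha=-\frac{b^2}{\kappa^2-1}\cdot\frac{\kappa q+\rho+(\kappa^2-1)x\cdot\nabla\rho}{q}$, $\beta=\frac{b^2}q$. $$\mathcal M=b(\mathrm{Id}-x\otimes x)+\beta[\nabla\rho-(\rho+x\cdot\nabla\rho)x]\otimes[\nabla\rho-(x\cdot\nabla\rho)x],$$ $$\mu_0=\mu_2^{-1}\mu_1=\rho\,\mathrm{Id}+x\otimes\nabla\rho+y\otimes\big[\rho x-\rho y-(X\cdot Y)\nabla\rho\big],$$ where $$\mu_1=\rho\,\mathrm{Id}+x\otimes\nabla\rho-\frac1{\nabla\psi\cdot Y}\Big(\rho\,y\otimes\widehat\nabla\psi-\frac{\rho\,\psi^{n+1}}{x_{n+1}}y\otimes x+(\nabla\psi\cdot X)\,y\otimes\nabla\rho\Big),$$ $$\mu_2=\mathrm{Id}-\frac1{\nabla\psi\cdot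 Y}\,y\otimes\Big(\widehat\nabla\psi-\frac{\psi^{n+1}}{y_{n+1}}y\Big),$$ and $$\mathcal A=b\,\mathcal M^{-1}\mu_0,\qquad \mathcal B=b\,\mathcal M^{-1}\Big\{(\kappa-b(\rho+x\cdot\nabla\rho))\mathrm{Id}+\big[\alpha(\nabla\rho-(\rho+x\cdot\nabla\rho)x)-2bx\big]\otimes\nabla\rho\Big\}.$$
   Formalization: Proved as |left side| = right side, and without absolute value where det Dz>0 (z: first n components of Z), as the sign can fail; μ0 is μ2^{-1}μ1 (the printed closed form needs ρ(y_{n+1}/x_{n+1})x for ρx); points with q=0 or t=0 are excluded; Z(x) is the first hit. *)

theory Defs
  imports "HOL-Analysis.Analysis"
begin

text \<open>
  Points of \<open>\<real>\<^sup>n\<close> are modelled by \<^typ>\<open>real^'n\<close>, points \<open>(x, x\<^bsub>n+1\<^esub>)\<close> of \<open>\<real>\<^bsup>n+1\<^esup>\<close> by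
  \<^typ>\<open>(real^'n) \<times> real\<close>, whose library norm and inner product are the Euclidean ones.
\<close>

definition grad :: "('a::euclidean_space \<Rightarrow> real) \<Rightarrow> 'a \<Rightarrow> 'a" where
  "grad h x = (THE D. GDERIV h x :> D)"

definition hessian :: "(real^'n \<Rightarrow> real) \<Rightarrow> real^'n \<Rightarrow> real^'n^'n" where
  "hessian h x = matrix (frechet_derivative (grad h) (at x))"

text \<open>\<open>Ck_on k S h\<close>: on the open set \<open>S\<close>, all partial derivatives of \<open>h\<close> up to order \<open>k\<close>
  exist and are continuous.\<close>

fun Ck_on :: "nat \<Rightarrow> 'a::euclidean_space set \<Rightarrow> ('a \<Rightarrow> real) \<Rightarrow> bool" where
  "Ck_on 0 S h \<longleftrightarrow> continuous_on S h"
| "Ck_on (Suc k) S h \<longleftrightarrow>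
     (\<forall>x\<in>S. h differentiable (at x)) \<and> (\<forall>i\<in>Basis. Ck_on k S (\<lambda>x. grad h x \<bullet> i))"

definition smooth_on :: "'a::euclidean_space set \<Rightarrow> ('a \<Rightarrow> real) \<Rightarrow> bool" where
  "smooth_on S h \<longleftrightarrow> (\<forall>k. Ck_on k S h)"

text \<open>Smoothness of a function on a relatively open piece \<open>A\<close> of a hypersurface: locally it is
  the restriction of a smooth function of the ambient space.\<close>

definition smooth_along :: "'a::euclidean_space set \<Rightarrow> ('a \<Rightarrow> real) \<Rightarrow> bool" where
  "smooth_along A h \<longleftrightarrow>
     (\<forall>p\<in>A. \<exists>W H. open W \<and> p \<in> W \<and> smooth_on W H \<and> (\<forall>z\<in>A \<inter> W. H z = h z))"

definition regular_hypersurface :: "('a::euclidean_space \<Rightarrow> real) \<Rightarrow> bool" where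
  "regular_hypersurface \<psi> \<longleftrightarrow> smooth_on UNIV \<psi> \<and> (\<forall>z. \<psi> z = 0 \<longrightarrow> grad \<psi> z \<noteq> 0)"

definition regular_parametrization ::
    "((real^'n) \<times> real) set \<Rightarrow> (real^'n) set \<Rightarrow> (real^'n \<Rightarrow> (real^'n) \<times> real)
      \<Rightarrow> (real^'n \<Rightarrow> real^'n \<Rightarrow> (real^'n) \<times> real) \<Rightarrow> bool" where
  "regular_parametrization S D \<phi> \<phi>' \<longleftrightarrow>
     open D \<and> inj_on \<phi> D \<and> \<phi> ` D \<subseteq> S \<and>
     (\<forall>u\<in>D. (\<phi> has_derivative \<phi>' u) (at u) \<and> inj (\<phi>' u)) \<and>
     (\<forall>h. continuous_on D (\<lambda>u. \<phi>' u h))"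

definition area_element :: "(real^'n \<Rightarrow> (real^'n) \<times> real) \<Rightarrow> real" where
  "area_element L = sqrt (det (\<chi> i j. L (axis i 1) \<bullet> L (axis j 1)))"

text \<open>The surface measure of a hypersurface \<open>S\<close> is the Borel measure on \<open>S\<close> given by
  \<open>\<sigma>(\<phi>(B)) = \<integral>\<^sub>B sqrt (det (D\<phi>\<^sup>t D\<phi>)) du\<close> in every local parametrization; as countably many
  parametrizations cover \<open>S\<close>, this determines \<open>\<sigma>\<close>.\<close>

definition is_surface_measure ::
    "((real^'n) \<times> real) set \<Rightarrow> ((real^'n) \<times> real) measure \<Rightarrow> bool" where
  "is_surface_measure S \<sigma> \<longleftrightarrow>
     sets \<sigma> = sets (restrict_space borel S) \<and>
     (\<forall>D \<phi> \<phi>'. regular_parametrization S D \<phi> \<phi>' \<longrightarrow>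
        (\<forall>B\<in>sets borel. B \<subseteq> D \<longrightarrow>
           emeasure \<sigma> (\<phi> ` B) = (\<integral>\<^sup>+u\<in>B. ennreal (area_element (\<phi>' u)) \<partial>lborel)))"

definition upper_hemisphere :: "((real^'n) \<times> real) set" where
  "upper_hemisphere = {X. norm X = 1 \<and> snd X > 0}"

definition hemi :: "real^'n \<Rightarrow> (real^'n) \<times> real" where
  "hemi x = (x, sqrt (1 - (norm x)\<^sup>2))"

definition chart_dom :: "((real^'n) \<times> real) set \<Rightarrow> (real^'n) set" where
  "chart_dom E = {x. norm x < 1 \<and> hemi x \<in> E}"

definition refr_pt :: "(real^'n \<Rightarrow> real) \<Rightarrow> real^'n \<Rightarrow> (real^'n) \<times> real" where
  "refr_pt \<rho> x = \<rho> x *\<^sub>R hemi x"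

definition refr_normal :: "(real^'n \<Rightarrow> real) \<Rightarrow> real^'n \<Rightarrow> (real^'n) \<times> real" where
  "refr_normal \<rho> x =
     - (1 / sqrt ((\<rho> x)\<^sup>2 + (norm (grad \<rho> x))\<^sup>2 - (x \<bullet> grad \<rho> x)\<^sup>2)) *\<^sub>R
       ((grad \<rho> x, 0) - (\<rho> x + x \<bullet> grad \<rho> x) *\<^sub>R hemi x)"

definition snell_radicand :: "real \<Rightarrow> (real^'n \<Rightarrow> real) \<Rightarrow> real^'n \<Rightarrow> real" where
  "snell_radicand \<kappa> \<rho> x = 1 - \<kappa>\<^sup>2 * (1 - (hemi x \<bullet> refr_normal \<rho> x)\<^sup>2)"

definition snell_lambda :: "real \<Rightarrow> (real^'n \<Rightarrow> real) \<Rightarrow> real^'n \<Rightarrow> real" where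
  "snell_lambda \<kappa> \<rho> x =
     hemi x \<bullet> refr_normal \<rho> x - (1 / \<kappa>) * sqrt (snell_radicand \<kappa> \<rho> x)"

text \<open>Snell's law \<open>X - Y / \<kappa> = \<lambda> \<nu>\<close>, solved for the refracted direction \<open>Y\<close>.\<close>

definition refr_dir :: "real \<Rightarrow> (real^'n \<Rightarrow> real) \<Rightarrow> real^'n \<Rightarrow> (real^'n) \<times> real" where
  "refr_dir \<kappa> \<rho> x = \<kappa> *\<^sub>R (hemi x - snell_lambda \<kappa> \<rho> x *\<^sub>R refr_normal \<rho> x)"

text \<open>A ray hits \<open>S\<close> at its first point of contact with \<open>S\<close>.\<close>

definition ray_hits ::
    "'a::real_vector set \<Rightarrow> 'a \<Rightarrow> 'a \<Rightarrow> 'a \<Rightarrow> bool" where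
  "ray_hits S P Y z \<longleftrightarrow>
     z \<in> S \<and> (\<exists>s\<ge>0. z = P + s *\<^sub>R Y \<and> (\<forall>r. 0 \<le> r \<and> r < s \<longrightarrow> P + r *\<^sub>R Y \<notin> S))"

definition stretch ::
    "(real^'n \<Rightarrow> real) \<Rightarrow> (real^'n \<Rightarrow> (real^'n) \<times> real) \<Rightarrow> real^'n \<Rightarrow> real" where
  "stretch \<rho> Z x = norm (Z x - refr_pt \<rho> x)"

text \<open>Energy balance for the map \<open>\<R>(E) = Z ` chart_dom E\<close>.  The image of a Borel set need not be
  Borel, hence the completion of the surface measure \<open>\<tau>\<close> of the receiver.\<close>

definition solves_near_field_refractor ::
    "((real^'n) \<times> real) set \<Rightarrow> ((real^'n) \<times> real) set
      \<Rightarrow> ((real^'n) \<times> real \<Rightarrow> real) \<Rightarrow> ((real^'n) \<times> real \<Rightarrow> real)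
      \<Rightarrow> ((real^'n) \<times> real) measure \<Rightarrow> ((real^'n) \<times> real) measure
      \<Rightarrow> (real^'n \<Rightarrow> (real^'n) \<times> real) \<Rightarrow> bool" where
  "solves_near_field_refractor U V f g \<sigma> \<tau> Z \<longleftrightarrow>
     (\<forall>x\<in>chart_dom U. Z x \<in> V) \<and>
     (\<forall>E\<in>sets borel. E \<subseteq> U \<longrightarrow>
        Z ` chart_dom E \<in> sets (completion \<tau>) \<and>
        set_lebesgue_integral \<sigma> E f = set_lebesgue_integral (completion \<tau>) (Z ` chart_dom E) g)"

definition outer :: "real^'n \<Rightarrow> real^'n \<Rightarrow> real^'n^'n" where
  "outer \<xi> \<eta> = (\<chi> i j. \<xi> $ i * \<eta> $ j)"

definition coef_a :: "(real^'n \<Rightarrow> real) \<Rightarrow> real^'n \<Rightarrow> real" where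
  "coef_a \<rho> x = (\<rho> x)\<^sup>2 + (norm (grad \<rho> x))\<^sup>2 - (grad \<rho> x \<bullet> x)\<^sup>2"

definition coef_q :: "real \<Rightarrow> (real^'n \<Rightarrow> real) \<Rightarrow> real^'n \<Rightarrow> real" where
  "coef_q \<kappa> \<rho> x = sqrt (coef_a \<rho> x - \<kappa>\<^sup>2 * (coef_a \<rho> x - (\<rho> x)\<^sup>2))"

definition coef_b :: "real \<Rightarrow> (real^'n \<Rightarrow> real) \<Rightarrow> real^'n \<Rightarrow> real" where
  "coef_b \<kappa> \<rho> x =
     (\<kappa> * \<rho> x - sqrt ((\<rho> x)\<^sup>2 + (1 - \<kappa>\<^sup>2) * ((norm (grad \<rho> x))\<^sup>2 - (grad \<rho> x \<bullet> x)\<^sup>2)))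
     / ((\<rho> x)\<^sup>2 + (norm (grad \<rho> x))\<^sup>2 - (grad \<rho> x \<bullet> x)\<^sup>2)"

definition coef_alpha :: "real \<Rightarrow> (real^'n \<Rightarrow> real) \<Rightarrow> real^'n \<Rightarrow> real" where
  "coef_alpha \<kappa> \<rho> x =
     - ((coef_b \<kappa> \<rho> x)\<^sup>2 / (\<kappa>\<^sup>2 - 1)) *
       ((\<kappa> * coef_q \<kappa> \<rho> x + \<rho> x + (\<kappa>\<^sup>2 - 1) * (x \<bullet> grad \<rho> x)) / coef_q \<kappa> \<rho> x)"

definition coef_beta :: "real \<Rightarrow> (real^'n \<Rightarrow> real) \<Rightarrow> real^'n \<Rightarrow> real" where
  "coef_beta \<kappa> \<rho> x = (coef_b \<kappa> \<rho> x)\<^sup>2 / coef_q \<kappa> \<rho> x"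

definition mat_M :: "real \<Rightarrow> (real^'n \<Rightarrow> real) \<Rightarrow> real^'n \<Rightarrow> real^'n^'n" where
  "mat_M \<kappa> \<rho> x =
     coef_b \<kappa> \<rho> x *\<^sub>R (mat 1 - outer x x) +
     coef_beta \<kappa> \<rho> x *\<^sub>R
       outer (grad \<rho> x - (\<rho> x + x \<bullet> grad \<rho> x) *\<^sub>R x) (grad \<rho> x - (x \<bullet> grad \<rho> x) *\<^sub>R x)"

definition mat_mu1 ::
    "real \<Rightarrow> (real^'n \<Rightarrow> real) \<Rightarrow> ((real^'n) \<times> real \<Rightarrow> real) \<Rightarrow> (real^'n \<Rightarrow> (real^'n) \<times> real)
      \<Rightarrow> real^'n \<Rightarrow> real^'n^'n" where
  "mat_mu1 \<kappa> \<rho> \<psi> Z x =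
     (let X = hemi x; Y = refr_dir \<kappa> \<rho> x; y = fst Y; N = grad \<psi> (Z x)
      in \<rho> x *\<^sub>R mat 1 + outer x (grad \<rho> x) -
         (1 / (N \<bullet> Y)) *\<^sub>R
           (\<rho> x *\<^sub>R outer y (fst N) - (\<rho> x * snd N / snd X) *\<^sub>R outer y x
             + (N \<bullet> X) *\<^sub>R outer y (grad \<rho> x)))"

definition mat_mu2 ::
    "real \<Rightarrow> (real^'n \<Rightarrow> real) \<Rightarrow> ((real^'n) \<times> real \<Rightarrow> real) \<Rightarrow> (real^'n \<Rightarrow> (real^'n) \<times> real)
      \<Rightarrow> real^'n \<Rightarrow> real^'n^'n" where
  "mat_mu2 \<kappa> \<rho> \<psi> Z x =
     (let Y = refr_dir \<kappa> \<rho> x; y = fst Y; N = grad \<psi> (Z x)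
      in mat 1 - (1 / (N \<bullet> Y)) *\<^sub>R outer y (fst N - (snd N / snd Y) *\<^sub>R y))"

text \<open>Expanding the product \<open>\<mu>\<^sub>2\<^sup>-\<^sup>1 \<mu>\<^sub>1\<close> gives
  \<open>\<rho> Id + x \<otimes> \<nabla>\<rho> + y \<otimes> [\<rho> (y\<^bsub>n+1\<^esub> / x\<^bsub>n+1\<^esub>) x - \<rho> y - (X \<bullet> Y) \<nabla>\<rho>]\<close>; the
  factor \<open>y\<^bsub>n+1\<^esub> / x\<^bsub>n+1\<^esub>\<close> cannot be dropped.\<close>

definition mat_mu0 ::
    "real \<Rightarrow> (real^'n \<Rightarrow> real) \<Rightarrow> ((real^'n) \<times> real \<Rightarrow> real) \<Rightarrow> (real^'n \<Rightarrow> (real^'n) \<times> real)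
      \<Rightarrow> real^'n \<Rightarrow> real^'n^'n" where
  "mat_mu0 \<kappa> \<rho> \<psi> Z x = matrix_inv (mat_mu2 \<kappa> \<rho> \<psi> Z x) ** mat_mu1 \<kappa> \<rho> \<psi> Z x"

definition mat_A ::
    "real \<Rightarrow> (real^'n \<Rightarrow> real) \<Rightarrow> ((real^'n) \<times> real \<Rightarrow> real) \<Rightarrow> (real^'n \<Rightarrow> (real^'n) \<times> real)
      \<Rightarrow> real^'n \<Rightarrow> real^'n^'n" where
  "mat_A \<kappa> \<rho> \<psi> Z x =
     coef_b \<kappa> \<rho> x *\<^sub>R (matrix_inv (mat_M \<kappa> \<rho> x) ** mat_mu0 \<kappa> \<rho> \<psi> Z x)"

definition mat_B :: "real \<Rightarrow> (real^'n \<Rightarrow> real) \<Rightarrow> real^'n \<Rightarrow> real^'n^'n" where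
  "mat_B \<kappa> \<rho> x =
     coef_b \<kappa> \<rho> x *\<^sub>R (matrix_inv (mat_M \<kappa> \<rho> x) **
       ((\<kappa> - coef_b \<kappa> \<rho> x * (\<rho> x + x \<bullet> grad \<rho> x)) *\<^sub>R mat 1 +
        outer (coef_alpha \<kappa> \<rho> x *\<^sub>R (grad \<rho> x - (\<rho> x + x \<bullet> grad \<rho> x) *\<^sub>R x)
                 - (2 * coef_b \<kappa> \<rho> x) *\<^sub>R x)
              (grad \<rho> x)))"

definition refractor_lhs ::
    "real \<Rightarrow> (real^'n \<Rightarrow> real) \<Rightarrow> ((real^'n) \<times> real \<Rightarrow> real) \<Rightarrow> (real^'n \<Rightarrow> (real^'n) \<times> real)
      \<Rightarrow> real^'n \<Rightarrow> real" where
  "refractor_lhs \<kappa> \<rho> \<psi> Z x =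
     det (mat_M \<kappa> \<rho> x) *
     det (hessian \<rho> x
          + (1 / (coef_b \<kappa> \<rho> x * stretch \<rho> Z x)) *\<^sub>R mat_A \<kappa> \<rho> \<psi> Z x
          + (1 / coef_b \<kappa> \<rho> x) *\<^sub>R mat_B \<kappa> \<rho> x)"

definition refractor_rhs ::
    "real \<Rightarrow> (real^'n \<Rightarrow> real) \<Rightarrow> ((real^'n) \<times> real \<Rightarrow> real) \<Rightarrow> (real^'n \<Rightarrow> (real^'n) \<times> real)
      \<Rightarrow> ((real^'n) \<times> real \<Rightarrow> real) \<Rightarrow> ((real^'n) \<times> real \<Rightarrow> real) \<Rightarrow> real^'n \<Rightarrow> real" where
  "refractor_rhs \<kappa> \<rho> \<psi> Z f g x =
     f (hemi x) / g (Z x) * (snd (refr_dir \<kappa> \<rho> x) / snd (hemi x)) *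
     (grad \<psi> (Z x) \<bullet> refr_dir \<kappa> \<rho> x / norm (grad \<psi> (Z x))) *
     (1 / stretch \<rho> Z x ^ CARD('n))"

text \<open>Jacobian determinant of \<open>x \<mapsto> z\<close> for \<open>Z = (z, z\<^bsub>n+1\<^esub>)\<close>.  The energy balance determines it
  only up to sign; where \<open>\<psi>\<^bsup>n+1\<^esup> > 0\<close>, \<open>z\<close> is a local coordinate on the receiver and a positive
  sign means that \<open>x \<mapsto> Z x\<close> preserves the orientation.\<close>

definition refractor_jacobian :: "(real^'n \<Rightarrow> (real^'n) \<times> real) \<Rightarrow> real^'n \<Rightarrow> real" where
  "refractor_jacobian Z x = det (matrix (frechet_derivative (\<lambda>u. fst (Z u)) (at x)))"

end

theory Submission
  imports Defs
begin

text \<open>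
  Along the refractor, \<open>Y = \<kappa> X - b ((\<rho> + x \<bullet> \<nabla>\<rho>) X - (\<nabla>\<rho>, 0))\<close>, and \<open>b\<close> is a root of
  \<open>a b\<^sup>2 - 2 \<kappa> \<rho> b + \<kappa>\<^sup>2 - 1 = 0\<close>. Differentiating this with the help of the quadratic equation gives
  \<open>Dy = \<M> D\<^sup>2\<rho> + b\<^sup>-\<^sup>1 \<M> \<B>\<close>. As the contact with the receiver is transversal, the stretch
  function is differentiable, and eliminating its gradient by means of \<open>\<nabla>\<psi> \<bullet> DZ = 0\<close> yields
  \<open>Dz = t \<mu>\<^sub>2 Dy + \<mu>\<^sub>1 = t \<mu>\<^sub>2 \<M> (D\<^sup>2\<rho> + \<A> / (b t) + \<B> / b)\<close>, where the determinants of
  \<open>\<mu>\<^sub>2\<close> and \<open>\<M>\<close> are explicit because both are rank one perturbations. Finally, the energy balance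
  on the images of small balls around \<open>x\<close> determines \<open>\<bar>det Dz\<bar>\<close>. At points with \<open>det Dz \<noteq> 0\<close> the
  map \<open>Z\<close> is itself a local parametrization of the receiver; at points with \<open>det Dz = 0\<close> the image
  of a ball of radius \<open>r\<close> has area \<open>o(r\<^sup>n)\<close>.
\<close>

section \<open>Rank one perturbations and area elements\<close>

text \<open>The balance compares integrals over E and over the image set Z(E). It carries no
  multiplicities, Z is not known to be injective, and nothing excludes det Dz = 0 beforehand.
  Therefore only limits of quotients by the volume of \<open>cball x r\<close> are compared, one
  point at a time, so that local information about Z suffices. The limit contains the absolute value
  of det Dz, and the sign of the left-hand side has to come from \<open>refractor_jacobian\<close>.
  The stretch function is defined by a first contact and comes without any regularity. Its
  continuity must be extracted from that minimality before the equation \<psi>(Z) = 0 can be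
  linearised in it. Two loci are excluded: q = 0, where the refracted ray is tangent to \<Gamma> and
  the square root in q need not be differentiable, and t = 0, where the equation divides by zero. Dy
  and Dz are written without inverse matrices, so their continuity presupposes no invertibility; the
  inverses of M and \<mu>2 enter only when determinants are compared.\<close>

lemma outer_mult_vec: "outer u v *v h = (v \<bullet> h) *\<^sub>R u"
  by (simp add: outer_def vec_eq_iff matrix_vector_mult_def inner_vec_def sum_distrib_left mult_ac)

lemma scaleR_matrix_vector: "(c *\<^sub>R A) *v h = c *\<^sub>R (A *v h)" for A :: "real^'n^'m"
  by (simp add: vec_eq_iff matrix_vector_mult_def sum_distrib_left mult_ac)

lemma matrix_scaleR_matrix: "A ** (c *\<^sub>R B) = c *\<^sub>R (A ** B)" for A :: "real^'n^'m"
  by (simp add: vec_eq_iff matrix_matrix_mult_def sum_distrib_left mult_ac)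

lemma matrix_inv_left: "invertible A \<Longrightarrow> matrix_inv A ** A = mat 1"
  and matrix_inv_right: "invertible A \<Longrightarrow> A ** matrix_inv A = mat 1"
  using someI_ex[of "\<lambda>A'. A ** A' = mat 1 \<and> A' ** A = mat 1"]
  by (auto simp: invertible_def matrix_inv_def)

lemma det_scaleR: "det (c *\<^sub>R A) = c ^ CARD('n) * det A" for A :: "real^'n^'n"
proof -
  have "c *\<^sub>R A = (\<chi> i. c *s A $ i)" by (simp add: vec_eq_iff)
  then show ?thesis by (simp add: det_rows_mul)
qed

lemma continuous_on_outer [continuous_intros]:
  fixes u v :: "'a::topological_space \<Rightarrow> real^'n"
  shows "continuous_on S u \<Longrightarrow> continuous_on S v \<Longrightarrow> continuous_on S (\<lambda>x. outer (u x) (v x))"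
  unfolding outer_def by (intro continuous_intros continuous_on_vec_lambda)

lemma continuous_on_matrix_mult [continuous_intros]:
  fixes A B :: "'a::topological_space \<Rightarrow> real^'n^'n"
  shows "continuous_on S A \<Longrightarrow> continuous_on S B \<Longrightarrow> continuous_on S (\<lambda>x. A x ** B x)"
  unfolding matrix_matrix_mult_def by (intro continuous_intros continuous_on_vec_lambda)

lemma continuous_on_det:
  fixes A :: "'a::topological_space \<Rightarrow> real^'n^'n"
  assumes "continuous_on S A"
  shows "continuous_on S (\<lambda>x. det (A x))"
  unfolding det_def by (intro continuous_intros assms)

text \<open>Only row k differs from the identity matrix, and it is the combination of the rows of
  the identity with coefficients \<open>axis k 1 + c w\<close>; Cramer's lemma reads off the
  determinant as the k-th coefficient.\<close>

lemma det_id_plus_outer_axis: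
  fixes w :: "real^'n"
  shows "det (mat 1 + outer (axis k c) w) = 1 + c * w $ k"
proof -
  let ?x = "axis k 1 + c *\<^sub>R w :: real^'n"
  have r: "row i (mat 1 :: real^'n^'n) = axis i 1" for i
    by (simp add: row_def mat_def axis_def vec_eq_iff)
  have "mat 1 + outer (axis k c) w =
    (\<chi> i. if i = k then (\<Sum>i\<in>UNIV. ?x $ i *s row i (mat 1)) else row i (mat 1))"
    unfolding r basis_expansion
    by (auto simp: vec_eq_iff mat_def outer_def axis_def)
  then have "det (mat 1 + outer (axis k c) w) = ?x $ k"
    using cramer_lemma_transpose[of k ?x "mat 1"] by simp
  then show ?thesis by simp
qed

text \<open>An orthogonal matrix Q turns a coordinate axis into the direction of u. Conjugation by Q
  preserves the determinant and reduces the claim to the case of an axis.\<close>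

lemma det_id_plus_outer:
  fixes u v :: "real^'n"
  shows "det (mat 1 + outer u v) = 1 + u \<bullet> v"
proof (cases "u = 0")
  case True
  then have "mat 1 + outer u v = mat 1" by (simp add: outer_def vec_eq_iff)
  with True show ?thesis by simp
next
  case False
  \<comment> \<open>Any index would do; one is needed only to name a coordinate axis.\<close>
  define k :: 'n where "k = undefined"
  obtain Q :: "real^'n^'n" where Q: "orthogonal_matrix Q" "Q *v axis k 1 = u /\<^sub>R norm u"
    using orthogonal_matrix_exists_basis[of "u /\<^sub>R norm u"] False by (metis norm_sgn sgn_div_norm)
  define w where "w = transpose Q *v v"
  have QQ: "Q ** transpose Q = mat 1" using Q(1) by (simp add: orthogonal_matrix_def)
  have ax: "axis k (norm u) = norm u *\<^sub>R axis k (1::real)" by (simp add: vec_eq_iff axis_def)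
  have Qu: "Q *v axis k (norm u) = u"
    using Q(2) False by (simp add: ax matrix_vector_mult_scaleR)
  have "mat 1 + outer u v = Q ** (mat 1 + outer (axis k (norm u)) w) ** transpose Q"
    unfolding matrix_eq
  proof
    fix h
    have "w \<bullet> (transpose Q *v h) = (Q *v w) \<bullet> h"
      using dot_lmul_matrix[of w "transpose Q" h] by (metis vector_transpose_matrix)
    also have "Q *v w = v" by (simp add: w_def matrix_vector_mul_assoc QQ del: transpose_matrix_vector)
    finally have "w \<bullet> (transpose Q *v h) = v \<bullet> h" .
    then show "(mat 1 + outer u v) *v h = (Q ** (mat 1 + outer (axis k (norm u)) w) ** transpose Q) *v h"
      by (simp add: matrix_vector_mult_add_rdistrib outer_mult_vec QQ Qu matrix_vector_mult_scaleR
        matrix_vector_right_distrib flip: matrix_vector_mul_assoc del: transpose_matrix_vector)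
         (simp add: matrix_vector_mul_assoc QQ del: transpose_matrix_vector)
  qed
  then have "det (mat 1 + outer u v) = det Q * det (transpose Q) * (1 + norm u * w $ k)"
    by (simp add: det_mul det_id_plus_outer_axis)
  also have "det Q * det (transpose Q) = 1"
    by (metis QQ det_I det_mul)
  also have "norm u * w $ k = u \<bullet> v"
  proof -
    have "norm u * w $ k = w \<bullet> axis k (norm u)" by (simp add: inner_axis mult.commute)
    also have "\<dots> = v \<bullet> u"
      unfolding w_def using dot_lmul_matrix[of v Q "axis k (norm u)"] Qu
      by (simp add: transpose_matrix_vector)
    finally show ?thesis by (simp add: inner_commute)
  qed
  finally show ?thesis by simp
qed

lemma matrix_entry_inner: "A $ i $ j = axis i 1 \<bullet> (A *v axis j 1)" for A :: "real^'n^'m"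
  by (simp add: inner_axis' matrix_vector_mult_basis column_def)

text \<open>The Gram matrix of L factors as A^t (1 + w w^t) A. Here w is the slope of the tangent
  hyperplane over the first n coordinates, so the area splits into the Jacobian of the projected map
  and the factor of the graph.\<close>

lemma area_element_graph:
  fixes A :: "real^'n^'n"
  assumes "\<And>h. L h = (A *v h, w \<bullet> (A *v h))"
  shows "area_element L = \<bar>det A\<bar> * sqrt (1 + w \<bullet> w)"
proof -
  have "(\<chi> i j. L (axis i 1) \<bullet> L (axis j 1)) = transpose A ** (mat 1 + outer w w) ** A"
  proof (simp add: vec_eq_iff, intro allI)
    fix i j
    have "(transpose A ** (mat 1 + outer w w) ** A) $ i $ j =
        axis i 1 \<bullet> (transpose A *v ((A *v axis j 1) + (w \<bullet> (A *v axis j 1)) *\<^sub>R w))"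
      unfolding matrix_entry_inner[of _ i j]
      by (simp only: matrix_vector_mult_add_rdistrib outer_mult_vec matrix_vector_mul_lid
          flip: matrix_vector_mul_assoc)
    also have "\<dots> = (A *v axis i 1) \<bullet> ((A *v axis j 1) + (w \<bullet> (A *v axis j 1)) *\<^sub>R w)"
      using dot_lmul_matrix[of "axis i 1" "transpose A"] by (simp add: vector_transpose_matrix)
    finally show "L (axis i 1) \<bullet> L (axis j 1) = (transpose A ** (mat 1 + outer w w) ** A) $ i $ j"
      by (simp add: assms inner_add_right inner_commute)
  qed
  then have "area_element L = sqrt ((det A)\<^sup>2 * (1 + w \<bullet> w))"
    by (simp add: area_element_def det_mul det_id_plus_outer power2_eq_square)
  then show ?thesis by (simp add: real_sqrt_mult)
qed

section \<open>Gradient and Hessian\<close>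

lemma grad_eqI: "(h has_derivative (\<lambda>v. D \<bullet> v)) (at x) \<Longrightarrow> grad h x = D"
  unfolding grad_def
proof (rule the_equality)
  assume h: "(h has_derivative (\<lambda>v. D \<bullet> v)) (at x)"
  then show "GDERIV h x :> D" by (simp add: gderiv_def inner_commute)
  fix D' assume "GDERIV h x :> D'"
  then have "(h has_derivative (\<lambda>v. D' \<bullet> v)) (at x)" by (simp add: gderiv_def inner_commute)
  from has_derivative_unique[OF this h] show "D' = D" unfolding fun_eq_iff vector_eq_rdot .
qed

lemma grad_has_derivative:
  assumes "h differentiable (at x)"
  shows "(h has_derivative (\<lambda>v. grad h x \<bullet> v)) (at x)"
proof -
  obtain h' where h': "(h has_derivative h') (at x)"
    using assms by (auto simp: differentiable_def)
  interpret bounded_linear h' using h' by (rule has_derivative_bounded_linear)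
  have "h' = (\<lambda>v. (\<Sum>b\<in>Basis. h' b *\<^sub>R b) \<bullet> v)"
  proof
    fix v
    have "h' v = h' (\<Sum>b\<in>Basis. (v \<bullet> b) *\<^sub>R b)" by (simp add: euclidean_representation)
    also have "\<dots> = (\<Sum>b\<in>Basis. (v \<bullet> b) * h' b)" by (simp add: sum scaleR)
    finally show "h' v = (\<Sum>b\<in>Basis. h' b *\<^sub>R b) \<bullet> v"
      by (simp add: inner_sum_left inner_commute[of v] mult.commute)
  qed
  with h' have D: "(h has_derivative (\<lambda>v. (\<Sum>b\<in>Basis. h' b *\<^sub>R b) \<bullet> v)) (at x)"
    by simp
  from grad_eqI[OF D] D show ?thesis by simp
qed

lemma Ck_on_1_grad:
  assumes "Ck_on 1 S h"
  shows "x \<in> S \<Longrightarrow> (h has_derivative (\<lambda>v. grad h x \<bullet> v)) (at x)" "continuous_on S (grad h)"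
proof -
  show "x \<in> S \<Longrightarrow> (h has_derivative (\<lambda>v. grad h x \<bullet> v)) (at x)"
    using assms by (auto intro: grad_has_derivative)
  show "continuous_on S (grad h)"
    using assms by (subst continuous_on_componentwise) simp
qed

text \<open>\<open>Ck_on\<close> speaks only of iterated partial derivatives. Differentiability of
  the gradient is assembled from its components, and the entries of the Hessian are identified with
  second partials, which transfers their continuity to the matrix.\<close>

lemma Ck_on_2_grad:
  assumes "Ck_on 2 S h"
  shows "x \<in> S \<Longrightarrow> (h has_derivative (\<lambda>v. grad h x \<bullet> v)) (at x)"
    and "continuous_on S (grad h)"
    and "x \<in> S \<Longrightarrow> (grad h has_derivative (\<lambda>v. hessian h x *v v)) (at x)"
    and "continuous_on S (hessian h)"
proof -
  have 2: "Ck_on (Suc 1) S h" using assms by (simp add: numeral_eq_Suc)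
  have d: "(h has_derivative (\<lambda>v. grad h x \<bullet> v)) (at x)" if "x \<in> S" for x
    using 2 that by (intro grad_has_derivative) simp
  have 1: "Ck_on 1 S (\<lambda>x. grad h x \<bullet> i)" if "i \<in> Basis" for i
    using 2 that by simp
  have di: "((\<lambda>x. grad h x \<bullet> i) has_derivative (\<lambda>v. grad (\<lambda>x. grad h x \<bullet> i) x \<bullet> v)) (at x)"
    if "x \<in> S" "i \<in> Basis" for x i
    using Ck_on_1_grad(1)[OF 1] that by blast
  have gd: "(grad h has_derivative (\<lambda>v. \<Sum>i\<in>Basis. (grad (\<lambda>x. grad h x \<bullet> i) x \<bullet> v) *\<^sub>R i)) (at x)"
    if "x \<in> S" for x
    by (subst has_derivative_componentwise_within)
       (use di[OF that] in \<open>auto simp: inner_sum_left inner_Basis if_distrib cong: if_cong\<close>)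
  have g: "(grad h has_derivative (\<lambda>v. hessian h x *v v)) (at x)" if "x \<in> S" for x
  proof -
    have f: "(grad h has_derivative frechet_derivative (grad h) (at x)) (at x)"
      using gd[OF that] frechet_derivative_works differentiable_def by blast
    then have "linear (frechet_derivative (grad h) (at x))" by (rule has_derivative_linear)
    then have "(\<lambda>v. hessian h x *v v) = frechet_derivative (grad h) (at x)"
      by (simp add: hessian_def matrix_works)
    with f show ?thesis by simp
  qed
  have gc: "continuous_on S (grad h)"
    using has_derivative_continuous[OF g] by (simp add: continuous_at_imp_continuous_on)
  have ent: "hessian h x $ i $ j = grad (\<lambda>x. grad h x \<bullet> axis i 1) x \<bullet> axis j 1" if "x \<in> S" for x i j
  proof -
    have "((\<lambda>x. grad h x \<bullet> axis i 1) has_derivative (\<lambda>v. (hessian h x *v v) \<bullet> axis i 1)) (at x)"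
      using g[OF that] by (rule has_derivative_inner_left)
    from has_derivative_unique[OF this di[OF that]]
    have "(\<lambda>v. (hessian h x *v v) \<bullet> axis i 1) = (\<lambda>v. grad (\<lambda>x. grad h x \<bullet> axis i 1) x \<bullet> v)"
      by (simp add: axis_in_Basis_iff)
    then have "(hessian h x *v axis j 1) \<bullet> axis i 1 = grad (\<lambda>x. grad h x \<bullet> axis i 1) x \<bullet> axis j 1"
      by (rule fun_cong)
    then show ?thesis unfolding matrix_entry_inner[of _ i j] by (simp only: inner_commute)
  qed
  have "continuous_on S (\<lambda>x. hessian h x $ i $ j)" for i j
  proof -
    have "continuous_on S (\<lambda>x. grad (\<lambda>x. grad h x \<bullet> axis i 1) x \<bullet> axis j 1)"
      using Ck_on_1_grad(2)[OF 1, of "axis i 1"]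
      by (intro continuous_intros) (simp add: axis_in_Basis_iff)
    then show ?thesis by (rule continuous_on_eq) (simp only: ent)
  qed
  then have "continuous_on S (\<lambda>x. \<chi> i j. hessian h x $ i $ j)"
    by (intro continuous_on_vec_lambda)
  then show "continuous_on S (hessian h)" by simp
  show "x \<in> S \<Longrightarrow> (h has_derivative (\<lambda>v. grad h x \<bullet> v)) (at x)" 
    "x \<in> S \<Longrightarrow> (grad h has_derivative (\<lambda>v. hessian h x *v v)) (at x)" "continuous_on S (grad h)"
    using d g gc by auto
qed

lemma smooth_along_continuous: "smooth_along A h \<Longrightarrow> continuous_on A h"
  unfolding smooth_along_def continuous_on_eq_continuous_within
proof
  fix p assume "\<forall>p\<in>A. \<exists>W H. open W \<and> p \<in> W \<and> smooth_on W H \<and> (\<forall>z\<in>A \<inter> W. H z = h z)" and p: "p \<in> A"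
  then obtain W H where W: "open W" "p \<in> W" "smooth_on W H" "\<And>z. z \<in> A \<inter> W \<Longrightarrow> H z = h z" by metis
  have "Ck_on 0 W H" using W(3) unfolding smooth_on_def by blast
  then have "continuous (at p) H" using W by (simp add: continuous_on_eq_continuous_at)
  then have "continuous (at p within A) H" by (rule continuous_at_imp_continuous_at_within)
  moreover obtain d where "d > 0" "ball p d \<subseteq> W" using W openE by blast
  ultimately show "continuous (at p within A) h"
    using W p by (intro continuous_transform_within[of p A H d h]) (auto simp: subset_iff dist_commute)
qed

section \<open>The refracted direction\<close>

lemma snd_hemi_pos: "norm x < 1 \<Longrightarrow> 0 < snd (hemi x)"
  by (simp add: hemi_def abs_square_less_1)

lemma fst_hemi [simp]: "fst (hemi x) = x"
  by (simp add: hemi_def)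

lemma snd_hemi_sq: "norm x < 1 \<Longrightarrow> (snd (hemi x))\<^sup>2 = 1 - x \<bullet> x"
  using abs_square_less_1[of "norm x"] by (simp add: hemi_def dot_square_norm)

lemma hemi_inner_self: "norm x < 1 \<Longrightarrow> hemi x \<bullet> hemi x = 1"
  using snd_hemi_sq[of x] by (simp add: inner_prod_def power2_eq_square)

lemma coef_a_eq: "coef_a \<rho> x = (\<rho> x)\<^sup>2 + grad \<rho> x \<bullet> grad \<rho> x - (x \<bullet> grad \<rho> x)\<^sup>2"
  by (simp add: coef_a_def inner_commute dot_square_norm)

text \<open>Cauchy-Schwarz with |x| < 1. The quantity a is the squared length of the unnormalised
  normal (\<rho> + x.p) X - (p, 0), p being the gradient of \<rho>; its positivity makes the normal
  and the coefficient b well defined.\<close>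

lemma coef_a_ge:
  assumes "norm x < 1"
  shows "(\<rho> x)\<^sup>2 \<le> coef_a \<rho> x"
proof -
  have "(grad \<rho> x \<bullet> x)\<^sup>2 \<le> (grad \<rho> x \<bullet> grad \<rho> x) * (x \<bullet> x)" by (rule Cauchy_Schwarz_ineq)
  also have "\<dots> \<le> (norm (grad \<rho> x))\<^sup>2"
    using assms abs_square_less_1[of "norm x"]
    by (simp add: dot_square_norm mult_left_le)
  finally show ?thesis by (simp add: coef_a_def)
qed

lemma coef_a_pos: "norm x < 1 \<Longrightarrow> 0 < \<rho> x \<Longrightarrow> 0 < coef_a \<rho> x"
  using coef_a_ge[of x \<rho>] by (smt (verit) zero_less_power)

lemma coef_b_alt: "coef_b \<kappa> \<rho> x = (\<kappa> * \<rho> x - coef_q \<kappa> \<rho> x) / coef_a \<rho> x"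
  by (simp add: coef_b_def coef_q_def coef_a_def algebra_simps)

lemma refr_normal_eq:
  "refr_normal \<rho> x = (1 / sqrt (coef_a \<rho> x)) *\<^sub>R ((\<rho> x + x \<bullet> grad \<rho> x) *\<^sub>R hemi x - (grad \<rho> x, 0))"
  by (simp add: refr_normal_def coef_a_def inner_commute scaleR_diff_right)

lemma hemi_inner_refr_normal:
  assumes "norm x < 1"
  shows "hemi x \<bullet> refr_normal \<rho> x = \<rho> x / sqrt (coef_a \<rho> x)"
proof -
  have "hemi x \<bullet> (grad \<rho> x, 0) = x \<bullet> grad \<rho> x" by (simp add: inner_prod_def)
  then show ?thesis
    by (simp add: refr_normal_eq inner_diff_right hemi_inner_self[OF assms])
qed

lemma sqrt_snell_radicand:
  assumes "norm x < 1" "0 < \<rho> x"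
  shows "sqrt (snell_radicand \<kappa> \<rho> x) = coef_q \<kappa> \<rho> x / sqrt (coef_a \<rho> x)"
    and "coef_a \<rho> x * snell_radicand \<kappa> \<rho> x = coef_a \<rho> x - \<kappa>\<^sup>2 * (coef_a \<rho> x - (\<rho> x)\<^sup>2)"
proof -
  note a = coef_a_pos[of x \<rho>, OF assms]
  show *: "coef_a \<rho> x * snell_radicand \<kappa> \<rho> x = coef_a \<rho> x - \<kappa>\<^sup>2 * (coef_a \<rho> x - (\<rho> x)\<^sup>2)"
    using a by (simp add: snell_radicand_def hemi_inner_refr_normal[OF assms(1)] power_divide field_simps)
  show "sqrt (snell_radicand \<kappa> \<rho> x) = coef_q \<kappa> \<rho> x / sqrt (coef_a \<rho> x)"
    using a unfolding coef_q_def *[symmetric] by (simp add: real_sqrt_mult)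
qed

text \<open>Here b is \<kappa> times Snell's \<lambda>, divided by the length sqrt a of the
  unnormalised normal, so Y becomes free of the square root of a.\<close>

lemma refr_dir_eq:
  assumes "norm x < 1" "0 < \<rho> x" "\<kappa> \<noteq> 0"
  shows "refr_dir \<kappa> \<rho> x = \<kappa> *\<^sub>R hemi x
    - coef_b \<kappa> \<rho> x *\<^sub>R ((\<rho> x + x \<bullet> grad \<rho> x) *\<^sub>R hemi x - (grad \<rho> x, 0))"
proof -
  note a = coef_a_pos[of x \<rho>, OF assms(1,2)]
  let ?a = "coef_a \<rho> x" and ?w = "(\<rho> x + x \<bullet> grad \<rho> x) *\<^sub>R hemi x - (grad \<rho> x, 0)"
  have "\<kappa> * snell_lambda \<kappa> \<rho> x * (1 / sqrt ?a) = coef_b \<kappa> \<rho> x"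
    unfolding snell_lambda_def hemi_inner_refr_normal[OF assms(1)] sqrt_snell_radicand(1)[of x \<rho>, OF assms(1,2)]
      coef_b_alt
    using assms(3) a by (simp add: field_simps)
  moreover have "refr_dir \<kappa> \<rho> x = \<kappa> *\<^sub>R hemi x - (\<kappa> * snell_lambda \<kappa> \<rho> x * (1 / sqrt ?a)) *\<^sub>R ?w"
    unfolding refr_dir_def refr_normal_eq by (simp only: scaleR_diff_right scaleR_scaleR mult.assoc)
  ultimately show ?thesis by simp
qed

text \<open>The sign condition says that no total reflection occurs. It is essential for the
  identity, since \<open>sqrt\<close> is extended to negative arguments as an odd function.\<close>

lemma coef_q_sq:
  assumes "norm x < 1" "0 < \<rho> x" "0 \<le> snell_radicand \<kappa> \<rho> x"
  shows "(coef_q \<kappa> \<rho> x)\<^sup>2 = coef_a \<rho> x - \<kappa>\<^sup>2 * (coef_a \<rho> x - (\<rho> x)\<^sup>2)"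
  unfolding coef_q_def sqrt_snell_radicand(2)[of x \<rho>, OF assms(1,2), symmetric]
  using assms coef_a_pos[of x \<rho>] by simp

text \<open>Square q = \<kappa> \<rho> - a b and cancel a. Geometrically this is the condition |Y| =
  1, which is how \<open>norm_refr_dir\<close> uses it.\<close>

lemma coef_b_quadratic:
  assumes "norm x < 1" "0 < \<rho> x" "0 \<le> snell_radicand \<kappa> \<rho> x"
  shows "coef_a \<rho> x * (coef_b \<kappa> \<rho> x)\<^sup>2 - 2 * \<kappa> * \<rho> x * coef_b \<kappa> \<rho> x + \<kappa>\<^sup>2 - 1 = 0"
proof -
  let ?a = "coef_a \<rho> x" and ?b = "coef_b \<kappa> \<rho> x" and ?q = "coef_q \<kappa> \<rho> x"
  note a = coef_a_pos[of x \<rho>, OF assms(1,2)]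
  have "?q = \<kappa> * \<rho> x - ?a * ?b" using a by (simp add: coef_b_alt)
  then have "(\<kappa> * \<rho> x - ?a * ?b)\<^sup>2 = ?a - \<kappa>\<^sup>2 * (?a - (\<rho> x)\<^sup>2)" using coef_q_sq[OF assms] by simp
  then have "?a * (?a * ?b\<^sup>2 - 2 * \<kappa> * \<rho> x * ?b + \<kappa>\<^sup>2 - 1) = 0" by algebra
  with a show ?thesis by simp
qed

lemma coef_b_nonzero:
  assumes "norm x < 1" "0 < \<rho> x" "0 \<le> snell_radicand \<kappa> \<rho> x" "0 < \<kappa>" "\<kappa> \<noteq> 1"
  shows "coef_b \<kappa> \<rho> x \<noteq> 0"
  using coef_b_quadratic[OF assms(1-3)] assms(4,5) by (auto simp: power2_eq_1_iff)

lemma norm_refr_dir: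
  assumes "norm x < 1" "0 < \<rho> x" "0 \<le> snell_radicand \<kappa> \<rho> x" "\<kappa> \<noteq> 0"
  shows "refr_dir \<kappa> \<rho> x \<bullet> refr_dir \<kappa> \<rho> x = 1"
proof -
  let ?p = "grad \<rho> x" and ?X = "hemi x" and ?b = "coef_b \<kappa> \<rho> x"
  define m where "m = \<rho> x + x \<bullet> ?p"
  have XX: "?X \<bullet> ?X = 1" by (rule hemi_inner_self[OF assms(1)])
  have Xp: "?X \<bullet> (?p, 0) = x \<bullet> ?p" "(?p, 0) \<bullet> ?X = x \<bullet> ?p"
    by (simp_all add: inner_prod_def inner_commute)
  have pp: "(?p, 0::real) \<bullet> (?p, 0) = ?p \<bullet> ?p" by simp
  have "refr_dir \<kappa> \<rho> x \<bullet> refr_dir \<kappa> \<rho> x =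
     \<kappa>\<^sup>2 - 2 * \<kappa> * ?b * (m - x \<bullet> ?p) + ?b\<^sup>2 * (m\<^sup>2 - 2 * m * (x \<bullet> ?p) + ?p \<bullet> ?p)"
    unfolding refr_dir_eq[of x \<rho>, OF assms(1,2,4)] m_def[symmetric]
    by (simp only: inner_diff_left inner_diff_right inner_scaleR_left inner_scaleR_right XX Xp pp)
       (simp add: algebra_simps power2_eq_square)
  also have "\<dots> = 1"
    using coef_b_quadratic[OF assms(1-3)]
    by (simp add: m_def coef_a_eq algebra_simps power2_eq_square)
  finally show ?thesis .
qed

text \<open>M is b times the product of 1 + c u p^t and 1 - x x^t, since multiplying p^t by the
  second factor gives p^t - (x.p) x^t. Each factor has an explicit determinant. The first
  contributes \<rho> (\<kappa> - b (\<rho> + x.p)) / q, and the bracket times the last component of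
  X is the last component of Y.\<close>

lemma det_mat_M:
  fixes x :: "real^'n"
  assumes "norm x < 1" "0 < \<rho> x" "coef_q \<kappa> \<rho> x \<noteq> 0" "coef_b \<kappa> \<rho> x \<noteq> 0" "\<kappa> \<noteq> 0"
  shows "det (mat_M \<kappa> \<rho> x) =
    coef_b \<kappa> \<rho> x ^ CARD('n) * snd (hemi x) * \<rho> x * snd (refr_dir \<kappa> \<rho> x) / coef_q \<kappa> \<rho> x"
proof -
  let ?p = "grad \<rho> x" and ?b = "coef_b \<kappa> \<rho> x" and ?q = "coef_q \<kappa> \<rho> x" and ?\<beta> = "coef_beta \<kappa> \<rho> x"
    and ?a = "coef_a \<rho> x"
  define s where "s = x \<bullet> ?p"
  define u where "u = ?p - (\<rho> x + s) *\<^sub>R x"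
  note a = coef_a_pos[of x \<rho>, OF assms(1,2)]
  define c where "c = ?\<beta> / ?b"
  have \<beta>: "?\<beta> = ?b * c" using assms(4) by (simp add: c_def)
  have "mat_M \<kappa> \<rho> x = ?b *\<^sub>R ((mat 1 + outer (c *\<^sub>R u) ?p) ** (mat 1 + outer (- x) x))"
    unfolding matrix_eq
    by (simp add: mat_M_def matrix_vector_mult_add_rdistrib matrix_vector_mult_diff_rdistrib
      \<beta> outer_mult_vec scaleR_matrix_vector inner_diff_left inner_diff_right u_def s_def inner_commute[of ?p x]
      matrix_vector_right_distrib matrix_vector_mult_scaleR flip: matrix_vector_mul_assoc)
      (simp add: algebra_simps)
  then have "det (mat_M \<kappa> \<rho> x) = ?b ^ CARD('n) * ((1 + c * (u \<bullet> ?p)) * (1 - x \<bullet> x))"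
    by (simp add: det_scaleR det_mul det_id_plus_outer)
  also have "1 - x \<bullet> x = (snd (hemi x))\<^sup>2" using snd_hemi_sq[OF assms(1)] by simp
  also have "1 + c * (u \<bullet> ?p) = \<rho> x * (\<kappa> - ?b * (\<rho> x + s)) / ?q"
  proof -
    have u: "u \<bullet> ?p = ?a - (\<rho> x)\<^sup>2 - \<rho> x * s"
      by (simp add: u_def coef_a_eq inner_diff_left s_def algebra_simps power2_eq_square)
    have q: "?q = \<kappa> * \<rho> x - ?a * ?b" using a by (simp add: coef_b_alt)
    have "1 + c * (u \<bullet> ?p) = (?q + ?b * (u \<bullet> ?p)) / ?q"
      using assms(3,4) by (simp add: c_def coef_beta_def field_simps power2_eq_square)
    also have "?q + ?b * (u \<bullet> ?p) = \<rho> x * (\<kappa> - ?b * (\<rho> x + s))"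
      unfolding u q by (simp add: algebra_simps power2_eq_square)
    finally show ?thesis .
  qed
  finally show ?thesis
    by (simp add: refr_dir_eq[of x \<rho>, OF assms(1,2,5)] s_def power2_eq_square algebra_simps)
qed

text \<open>The Jacobian matrix of x \<mapsto> y. The second summand is M B / b with the inverse of
  M cancelled.\<close>

definition mat_Dy :: "real \<Rightarrow> (real^'n \<Rightarrow> real) \<Rightarrow> real^'n \<Rightarrow> real^'n^'n" where
  "mat_Dy \<kappa> \<rho> x = mat_M \<kappa> \<rho> x ** hessian \<rho> x +
     ((\<kappa> - coef_b \<kappa> \<rho> x * (\<rho> x + x \<bullet> grad \<rho> x)) *\<^sub>R mat 1 +
        outer (coef_alpha \<kappa> \<rho> x *\<^sub>R (grad \<rho> x - (\<rho> x + x \<bullet> grad \<rho> x) *\<^sub>R x)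
                 - (2 * coef_b \<kappa> \<rho> x) *\<^sub>R x)
              (grad \<rho> x))"

lemma coef_a_has_derivative:
  assumes "(\<rho> has_derivative (\<lambda>h. grad \<rho> x \<bullet> h)) (at x)"
    and "(grad \<rho> has_derivative (\<lambda>h. H *v h)) (at x)"
  shows "(coef_a \<rho> has_derivative (\<lambda>h. 2 * ((grad \<rho> x - (x \<bullet> grad \<rho> x) *\<^sub>R x) \<bullet> (H *v h))
            + 2 * (\<rho> x - x \<bullet> grad \<rho> x) * (grad \<rho> x \<bullet> h))) (at x)"
proof -
  have e: "coef_a \<rho> = (\<lambda>x. \<rho> x * \<rho> x + grad \<rho> x \<bullet> grad \<rho> x - (grad \<rho> x \<bullet> x) * (grad \<rho> x \<bullet> x))"
    by (simp add: coef_a_def fun_eq_iff dot_square_norm power2_eq_square)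
  show ?thesis
    unfolding e
    by (rule has_derivative_eq_rhs, (rule derivative_intros assms)+)
       (simp add: fun_eq_iff inner_diff_left inner_commute algebra_simps)
qed

lemma coef_b_has_derivative:
  assumes d: "(\<rho> has_derivative (\<lambda>h. grad \<rho> x \<bullet> h)) (at x)"
    "(grad \<rho> has_derivative (\<lambda>h. H *v h)) (at x)"
    and x: "norm x < 1" "0 < \<rho> x" "0 \<le> snell_radicand \<kappa> \<rho> x" "0 < \<kappa>" "\<kappa> \<noteq> 1"
    and q0: "coef_q \<kappa> \<rho> x \<noteq> 0"
  shows "(coef_b \<kappa> \<rho> has_derivative (\<lambda>h.
     coef_beta \<kappa> \<rho> x * ((grad \<rho> x - (x \<bullet> grad \<rho> x) *\<^sub>R x) \<bullet> (H *v h))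
     + coef_alpha \<kappa> \<rho> x * (grad \<rho> x \<bullet> h))) (at x)"
proof -
  let ?p = "grad \<rho> x" and ?b = "coef_b \<kappa> \<rho> x" and ?q = "coef_q \<kappa> \<rho> x" and ?a = "coef_a \<rho> x"
  define s where "s = x \<bullet> ?p"
  note a = coef_a_pos[of x \<rho>, OF x(1,2)]
  have e: "coef_b \<kappa> \<rho> = (\<lambda>x. (\<kappa> * \<rho> x - coef_q \<kappa> \<rho> x) / coef_a \<rho> x)"
    by (simp add: fun_eq_iff coef_b_alt)
  have eq: "coef_q \<kappa> \<rho> = (\<lambda>x. sqrt (coef_a \<rho> x - \<kappa>\<^sup>2 * (coef_a \<rho> x - \<rho> x * \<rho> x)))"
    by (simp add: fun_eq_iff coef_q_def power2_eq_square)
  define da where "da = (\<lambda>h. 2 * ((?p - s *\<^sub>R x) \<bullet> (H *v h)) + 2 * (\<rho> x - s) * (?p \<bullet> h))"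
  define dq where "dq = (\<lambda>h. ((1 - \<kappa>\<^sup>2) * da h + 2 * \<kappa>\<^sup>2 * \<rho> x * (?p \<bullet> h)) / (2 * ?q))"
  \<comment> \<open>Off the critical angle the radicand is strictly positive, so the square root may
    be differentiated.\<close>
  have qpos: "0 < ?a - \<kappa>\<^sup>2 * (?a - \<rho> x * \<rho> x)"
    using coef_q_sq[OF x(1-3)] q0 by (metis power2_eq_square zero_less_power2)
  have da: "(coef_a \<rho> has_derivative da) (at x)"
    unfolding da_def s_def by (rule coef_a_has_derivative[OF d])
  have dq: "(coef_q \<kappa> \<rho> has_derivative dq) (at x)"
  proof -
    have "((\<lambda>x. sqrt (coef_a \<rho> x - \<kappa>\<^sup>2 * (coef_a \<rho> x - \<rho> x * \<rho> x))) has_derivative dq) (at x)"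
      by (rule has_derivative_eq_rhs, (rule derivative_intros da d(1) qpos)+)
         (simp add: fun_eq_iff dq_def eq field_simps)
    then show ?thesis unfolding eq .
  qed
  have "(coef_b \<kappa> \<rho> has_derivative (\<lambda>h. (\<kappa> * (?p \<bullet> h) - dq h - ?b * da h) / ?a)) (at x)"
    unfolding e
    by (rule has_derivative_eq_rhs, (rule derivative_intros da dq d(1))+)
       (use a in \<open>auto simp: fun_eq_iff field_simps coef_b_alt\<close>)
  moreover have "(\<kappa> * (?p \<bullet> h) - dq h - ?b * da h) / ?a =
    coef_beta \<kappa> \<rho> x * ((?p - s *\<^sub>R x) \<bullet> (H *v h)) + coef_alpha \<kappa> \<rho> x * (?p \<bullet> h)" for h
  proof -
    define m where "m = (?p - s *\<^sub>R x) \<bullet> (H *v h)"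
    define c where "c = ?p \<bullet> h"
    define B where "B = ?b"
    define r where "r = \<rho> x"
    define A where "A = ?a"
    define Q where "Q = ?q"
    define K where "K = \<kappa>\<^sup>2 - 1"
    have k: "K \<noteq> 0" using x(4,5) by (auto simp: power2_eq_1_iff K_def)
    have Q: "Q = \<kappa> * r - A * B" using a by (simp add: coef_b_alt A_def B_def r_def Q_def)
    have quad: "A * B\<^sup>2 - 2 * \<kappa> * r * B + K = 0"
      using coef_b_quadratic[OF x(1-3)] by (simp add: A_def B_def r_def K_def)
    have "(\<kappa> * c - dq h - B * da h) * (2 * Q * K) = 
       (2 * \<kappa> * c * Q - (- K * (2 * m + 2 * (r - s) * c) + 2 * \<kappa>\<^sup>2 * r * c) - 2 * Q * B * (2 * m + 2 * (r - s) * c)) * K"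
      using q0 by (simp add: dq_def da_def m_def c_def Q_def r_def K_def divide_simps B_def)
    \<comment> \<open>After Q is replaced by \<kappa> r - A B, the two sides agree modulo the
      quadratic equation of B. Multiplying by K = \<kappa>^2 - 1 produces the denominator found in
      \<alpha>, and the factor A on the right cancels the one from the quotient rule.\<close>
    also have "\<dots> = (B\<^sup>2 * m * K - B\<^sup>2 * (\<kappa> * Q + r + K * s) * c) * (2 * A)"
      using quad unfolding Q K_def by algebra
    finally have *: "(\<kappa> * c - dq h - B * da h) * (2 * Q * K) = (B\<^sup>2 * m * K - B\<^sup>2 * (\<kappa> * Q + r + K * s) * c) * (2 * A)" .
    have "(\<kappa> * c - dq h - B * da h) / A = B\<^sup>2 / Q * m + (- (B\<^sup>2 / K) * ((\<kappa> * Q + r + K * s) / Q)) * c"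
      using * q0 a k unfolding Q_def[symmetric] A_def[symmetric]
      by (simp add: field_simps)
    then show ?thesis
      by (simp add: coef_beta_def coef_alpha_def A_def B_def K_def Q_def r_def m_def c_def s_def)
  qed
  ultimately show ?thesis by (simp add: s_def)
qed

lemma refr_dir_fst_has_derivative:
  assumes d: "(\<rho> has_derivative (\<lambda>h. grad \<rho> x \<bullet> h)) (at x)"
    "(grad \<rho> has_derivative (\<lambda>h. hessian \<rho> x *v h)) (at x)"
    and x: "norm x < 1" "0 < \<rho> x" "0 \<le> snell_radicand \<kappa> \<rho> x" "0 < \<kappa>" "\<kappa> \<noteq> 1"
    and q0: "coef_q \<kappa> \<rho> x \<noteq> 0"
  shows "((\<lambda>x. fst (refr_dir \<kappa> \<rho> x)) has_derivative (\<lambda>h. mat_Dy \<kappa> \<rho> x *v h)) (at x)"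
proof -
  note db = coef_b_has_derivative[OF d x q0]
  have "((\<lambda>x. \<kappa> *\<^sub>R x - coef_b \<kappa> \<rho> x *\<^sub>R ((\<rho> x + x \<bullet> grad \<rho> x) *\<^sub>R x - grad \<rho> x))
     has_derivative (\<lambda>h. mat_Dy \<kappa> \<rho> x *v h)) (at x)"
    by (rule has_derivative_eq_rhs, (rule derivative_intros db d)+)
       (simp add: fun_eq_iff mat_Dy_def mat_M_def matrix_vector_mult_add_rdistrib
         matrix_vector_mult_diff_rdistrib outer_mult_vec scaleR_matrix_vector inner_commute algebra_simps
        flip: matrix_vector_mul_assoc)
  \<comment> \<open>The closed form of Y is valid where |z| < 1 and \<rho> > 0, and these open
    conditions persist near x.\<close>
  moreover have "\<forall>\<^sub>F z in at x. fst (refr_dir \<kappa> \<rho> z) =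
      \<kappa> *\<^sub>R z - coef_b \<kappa> \<rho> z *\<^sub>R ((\<rho> z + z \<bullet> grad \<rho> z) *\<^sub>R z - grad \<rho> z)"
  proof -
    have "isCont \<rho> x" using d(1) by (rule has_derivative_continuous)
    then have "\<forall>\<^sub>F z in at x. 0 < \<rho> z" using x(2) by (simp add: isCont_def order_tendstoD)
    moreover have "((\<lambda>z. norm z) \<longlongrightarrow> norm x) (at x)" by (intro tendsto_intros)
    then have "\<forall>\<^sub>F z in at x. norm z < 1" using x(1) by (rule order_tendstoD)
    ultimately show ?thesis
      by eventually_elim (use x(4) in \<open>simp add: refr_dir_eq\<close>)
  qed
  ultimately show ?thesis
    using x by (elim has_derivative_transform_eventually)
      (auto simp: refr_dir_eq[of x \<rho>] elim: eventually_mono)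
qed

section \<open>Transversal first contact\<close>

text \<open>The hypothesis that the time is the \<^emph>\<open>first\<close> contact gives lower semicontinuity,
  transversality of the contact gives upper semicontinuity.\<close>

lemma first_hit_isCont:
  fixes P Y :: "'a::metric_space \<Rightarrow> 'b::euclidean_space" and \<psi> :: "'b \<Rightarrow> real"
  assumes "open G" "x0 \<in> G" "continuous_on G P" "continuous_on G Y" "continuous_on UNIV \<psi>"
    and hit: "\<And>x. x \<in> G \<Longrightarrow> 0 \<le> t x \<and> \<psi> (P x + t x *\<^sub>R Y x) = 0"
    and first: "\<And>x r. x \<in> G \<Longrightarrow> 0 \<le> r \<Longrightarrow> r < t x \<Longrightarrow> \<psi> (P x + r *\<^sub>R Y x) \<noteq> 0"
    and t0: "0 < t x0"
    and d: "(\<psi> has_derivative (\<lambda>v. N \<bullet> v)) (at (P x0 + t x0 *\<^sub>R Y x0))"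
    and NY: "0 < N \<bullet> Y x0"
  shows "isCont t x0"
proof -
  define F where "F = (\<lambda>(x, r). \<psi> (P x + r *\<^sub>R Y x))"
  have contF: "continuous_on (G \<times> UNIV) F"
    unfolding F_def case_prod_beta
    by (rule continuous_on_compose2[OF assms(5)])
       (auto intro!: continuous_intros continuous_on_compose2[OF assms(3)] continuous_on_compose2[OF assms(4)])
  have contr: "continuous_on UNIV (\<lambda>r. F (x, r))" if "x \<in> G" for x
    by (rule continuous_on_compose2[OF contF]) (use that in \<open>auto intro!: continuous_intros\<close>)
  have contx: "isCont (\<lambda>x. F (x, r)) x0" for r
  proof -
    have "continuous_on G (\<lambda>x. F (x, r))"
      by (rule continuous_on_compose2[OF contF]) (auto intro!: continuous_intros)
    then show ?thesis using assms(1,2) by (simp add: continuous_on_eq_continuous_at)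
  qed
  have "((\<lambda>r. F (x0, r)) has_derivative (\<lambda>r. N \<bullet> (r *\<^sub>R Y x0))) (at (t x0))"
    unfolding F_def prod.case
    by (rule has_derivative_compose[where g = \<psi> and f = "\<lambda>r. P x0 + r *\<^sub>R Y x0" and g' = "\<lambda>v. N \<bullet> v", OF _ d])
       (auto intro!: derivative_eq_intros)
  then have der: "((\<lambda>r. F (x0, r)) has_real_derivative N \<bullet> Y x0) (at (t x0))"
    by (rule has_derivative_imp_has_field_derivative) simp
  have F0: "F (x0, t x0) = 0" using hit[OF assms(2)] by (simp add: F_def)
  obtain d1 where d1: "0 < d1" "\<And>h. 0 < h \<Longrightarrow> h < d1 \<Longrightarrow> F (x0, t x0 - h) < 0"
    using DERIV_pos_inc_left[OF der NY] F0 by auto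
  obtain d2 where d2: "0 < d2" "\<And>h. 0 < h \<Longrightarrow> h < d2 \<Longrightarrow> 0 < F (x0, t x0 + h)"
    using DERIV_pos_inc_right[OF der NY] F0 by auto
  show ?thesis unfolding isCont_def tendsto_iff
  proof (intro allI impI)
    fix e :: real assume "0 < e"
    \<comment> \<open>Small enough that the signs of F at t x0 - h and t x0 + h are known from its
      positive derivative, and that t x0 - h stays positive.\<close>
    define h where "h = min e (min (t x0) (min d1 d2)) / 2"
    have h: "0 < h" "h < e" "h < t x0" "h < d1" "h < d2"
      using \<open>0 < e\<close> t0 d1(1) d2(1) by (auto simp: h_def)
    let ?r1 = "t x0 - h" and ?r2 = "t x0 + h"
    have F1: "F (x0, ?r1) < 0" and F2: "0 < F (x0, ?r2)" using h d1(2) d2(2) by auto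
    have nz: "F (x0, r) \<noteq> 0" if "r \<in> {0..?r1}" for r
      using first[OF assms(2), of r] that h(1) by (simp add: F_def)
    \<comment> \<open>W is open and contains the segment over x0 from 0 to t x0 - h. The tube lemma
      thickens the segment, so nearby rays have no contact up to that time.\<close>
    define W where "W = (G \<times> UNIV) \<inter> F -` (- {0})"
    have "open W"
      unfolding W_def using \<open>open G\<close> by (intro continuous_open_preimage contF open_Times) auto
    moreover have "{x0} \<times> {0..?r1} \<subseteq> W" using nz assms(2) by (auto simp: W_def)
    ultimately have "\<exists>X0. x0 \<in> X0 \<and> open X0 \<and> X0 \<times> {0..?r1} \<subseteq> W"
      by (rule Elementary_Topology.tube_lemma[OF compact_Icc])
    then obtain X0 where X0: "x0 \<in> X0" "open X0" "X0 \<times> {0..?r1} \<subseteq> W" by blast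
    have "\<forall>\<^sub>F x in at x0. x \<in> X0" using X0 by (simp add: eventually_at_topological) blast
    moreover have "\<forall>\<^sub>F x in at x0. x \<in> G" using assms(1,2) by (simp add: eventually_at_topological) blast
    moreover have "\<forall>\<^sub>F x in at x0. F (x, ?r1) < 0"
      using contx[of ?r1] F1 by (simp add: isCont_def order_tendstoD)
    moreover have "\<forall>\<^sub>F x in at x0. 0 < F (x, ?r2)"
      using contx[of ?r2] F2 by (simp add: isCont_def order_tendstoD)
    ultimately show "\<forall>\<^sub>F x in at x0. dist (t x) (t x0) < e"
    proof eventually_elim
      case (elim x)
      have "?r1 < t x"
      proof (rule ccontr)
        assume "\<not> ?r1 < t x"
        then have "(x, t x) \<in> W" using elim(1,2) hit X0(3) by (auto simp: subset_iff)
        then show False using hit[OF elim(2)] by (simp add: W_def F_def)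
      qed
      moreover have "t x \<le> ?r2"
      proof -
        \<comment> \<open>The sign change across the contact survives for nearby x and forces a zero
          in this interval; the first contact cannot be later.\<close>
        have "\<exists>r. ?r1 \<le> r \<and> r \<le> ?r2 \<and> F (x, r) = 0"
          using elim(3,4) h(1) continuous_on_subset[OF contr[OF elim(2)]] by (intro IVT') auto
        then obtain r where r: "?r1 \<le> r" "r \<le> ?r2" "F (x, r) = 0" by blast
        then show ?thesis using first[OF elim(2), of r] h by (fastforce simp: F_def)
      qed
      ultimately show ?case using h(2) by (simp add: dist_real_def)
    qed
  qed
qed

text \<open>Continuity of t puts (x, t x) into the range where the linearisation of F at one point
  is accurate. The linear part in the increment of t can then be solved for, provided that this
  increment is O(|h|).\<close>

lemma implicit_has_derivative:
  fixes F :: "'a::real_normed_vector \<times> real \<Rightarrow> real"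
  assumes F: "(F has_derivative (\<lambda>(h, k). A h + c * k)) (at (x0, t x0))"
    and c: "c \<noteq> 0" and t: "isCont t x0"
    and A: "bounded_linear A"
    and F0: "F (x0, t x0) = 0" and ev: "\<forall>\<^sub>F x in at x0. F (x, t x) = 0"
  shows "(t has_derivative (\<lambda>h. - A h / c)) (at x0)"
  unfolding has_derivative_at_within
proof (intro conjI)
  have "bounded_linear (\<lambda>h. (-1 / c) * A h)"
    by (rule bounded_linear_compose[OF bounded_linear_mult_right A])
  then show "bounded_linear (\<lambda>h. - A h / c)" by simp
  obtain K where K: "0 < K" "\<And>h. norm (A h) \<le> norm h * K" using bounded_linear.pos_bounded[OF A] by blast
  \<comment> \<open>The Lipschitz bound at x0: moving the remainder's share of |k| to the left costs
    at most half of |c| |k|, which leaves |c|/2 |k| \<le> (K + |c|) |h|.\<close>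
  define L where "L = 2 * (K + \<bar>c\<bar>) / \<bar>c\<bar>"
  have L: "0 < L" using K(1) c by (simp add: L_def add_pos_pos)
  have Fx: "((\<lambda>x. (x, t x)) \<longlongrightarrow> (x0, t x0)) (at x0)"
    using t by (auto simp: isCont_def intro!: tendsto_intros)
  show "((\<lambda>y. ((t y - t x0) - - A (y - x0) / c) /\<^sub>R norm (y - x0)) \<longlongrightarrow> 0) (at x0)"
  proof (rule tendstoI)
    fix e :: real assume "0 < e"
    \<comment> \<open>The first bound permits that absorption. The second makes the remainder, once
      |k| \<le> L |h| is known, at most e/2 |h|, which leaves room for the strict
      inequality.\<close>
    define e1 where "e1 = min (\<bar>c\<bar> / 2) (e * \<bar>c\<bar> / (2 * (1 + L)))"
    have e1: "0 < e1" "e1 \<le> \<bar>c\<bar> / 2" "e1 \<le> e * \<bar>c\<bar> / (2 * (1 + L))"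
      unfolding e1_def by ((use c \<open>0 < e\<close> L in simp), (rule min.cobounded1 min.cobounded2)+)
    obtain d where d: "0 < d" "\<And>y. norm (y - (x0, t x0)) < d \<Longrightarrow>
        norm (F y - F (x0, t x0) - (case y - (x0, t x0) of (h, k) \<Rightarrow> A h + c * k)) \<le> e1 * norm (y - (x0, t x0))"
      using F[unfolded has_derivative_at_alt] e1(1) by metis
    have "\<forall>\<^sub>F x in at x0. dist (x, t x) (x0, t x0) < d" using tendstoD[OF Fx d(1)] .
    then show "\<forall>\<^sub>F y in at x0. dist (((t y - t x0) - - A (y - x0) / c) /\<^sub>R norm (y - x0)) 0 < e"
      using ev eventually_neq_at_within[of x0]
    proof eventually_elim
      case (elim y)
      define h where "h = y - x0"
      define k where "k = t y - t x0"
      have h0: "0 < norm h" using elim(3) by (simp add: h_def)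
      have "\<bar>A h + c * k\<bar> \<le> e1 * norm (h, k)"
        using d(2)[of "(y, t y)"] elim(1,2) F0 by (simp add: dist_norm h_def k_def)
      also have "\<dots> \<le> e1 * (norm h + \<bar>k\<bar>)"
        using e1(1) norm_Pair_le[of h k] by simp
      finally have 1: "\<bar>A h + c * k\<bar> \<le> e1 * (norm h + \<bar>k\<bar>)" .
      have "\<bar>c\<bar> * \<bar>k\<bar> \<le> \<bar>A h\<bar> + \<bar>A h + c * k\<bar>" by (simp add: abs_mult[symmetric])
      also have "\<dots> \<le> norm h * K + e1 * norm h + e1 * \<bar>k\<bar>"
        using 1 K(2)[of h] by (simp add: algebra_simps)
      also have "\<dots> \<le> norm h * K + \<bar>c\<bar> * norm h + \<bar>c\<bar> / 2 * \<bar>k\<bar>"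
        using e1(2) c K(1) by (intro add_mono mult_right_mono) auto
      finally have "\<bar>c\<bar> / 2 * \<bar>k\<bar> \<le> (K + \<bar>c\<bar>) * norm h" by (simp add: algebra_simps)
      then have kL: "\<bar>k\<bar> \<le> L * norm h" using c by (simp add: L_def field_simps)
      have "\<bar>k - - A h / c\<bar> * \<bar>c\<bar> = \<bar>A h + c * k\<bar>"
        using c by (simp add: abs_mult[symmetric] algebra_simps)
      also have "\<dots> \<le> e1 * ((1 + L) * norm h)"
      proof -
        have "norm h + \<bar>k\<bar> \<le> (1 + L) * norm h" using kL by (simp add: distrib_right)
        then have "e1 * (norm h + \<bar>k\<bar>) \<le> e1 * ((1 + L) * norm h)" using e1(1) by (intro mult_left_mono) auto
        with 1 show ?thesis by linarith
      qed
      also have "\<dots> \<le> e * \<bar>c\<bar> / (2 * (1 + L)) * ((1 + L) * norm h)"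
        using e1(3) L by (intro mult_right_mono) auto
      also have "\<dots> = (e / 2 * norm h) * \<bar>c\<bar>" using L by (simp add: field_simps)
      finally have "\<bar>k - - A h / c\<bar> \<le> e / 2 * norm h" using c by simp
      also have "\<dots> < e * norm h" using \<open>0 < e\<close> h0 by simp
      finally have "\<bar>k - - A h / c\<bar> / norm h < e" using h0 by (simp add: pos_divide_less_eq)
      moreover have "dist (v /\<^sub>R norm h) 0 = \<bar>v\<bar> / norm h" for v :: real
        by (simp add: abs_mult divide_inverse)
      ultimately show ?case by (simp only: h_def k_def)
    qed
  qed
qed

section \<open>Surface integrals over shrinking sets\<close>

lemma inner_eq_0_imp_graph:
  fixes N :: "(real^'n) \<times> real"
  assumes "N \<bullet> v = 0" "snd N \<noteq> 0"
  shows "v = (fst v, - (1 / snd N) *\<^sub>R fst N \<bullet> fst v)"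
  using assms by (cases v) (simp add: inner_prod_def field_simps)

text \<open>The inverse function theorem is applied to \<Phi>(z) = (fst z, \<psi> z), which
  straightens the level set into a slice; \<phi> is the local inverse restricted to that
  slice.\<close>

lemma level_set_graph_chart:
  fixes \<psi> :: "(real^'n) \<times> real \<Rightarrow> real"
  assumes der: "\<And>z. (\<psi> has_derivative (\<lambda>v. grad \<psi> z \<bullet> v)) (at z)"
    and cont: "continuous_on UNIV (grad \<psi>)"
    and z0: "\<psi> z0 = 0" "snd (grad \<psi> z0) \<noteq> 0"
  obtains G D \<phi> where "open G" "z0 \<in> G" "fst z0 \<in> D" "\<phi> (fst z0) = z0"
    "regular_parametrization {z. \<psi> z = 0} D \<phi>
       (\<lambda>u h. (h, - (1 / snd (grad \<psi> (\<phi> u))) *\<^sub>R fst (grad \<psi> (\<phi> u)) \<bullet> h))"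
    "\<And>z. z \<in> G \<Longrightarrow> \<psi> z = 0 \<Longrightarrow> \<phi> (fst z) = z"
proof -
  let ?N = "grad \<psi>"
  define U where "U = {z. snd (?N z) \<noteq> 0}"
  define \<Phi> where "\<Phi> = (\<lambda>z. (fst z, \<psi> z))"
  define \<Phi>' where "\<Phi>' = (\<lambda>z. Blinfun (\<lambda>v. (fst v, ?N z \<bullet> v)))"
  have bl: "bounded_linear (\<lambda>v. (fst v, ?N z \<bullet> v))" for z
    by (intro bounded_linear_intros)
  have \<Phi>': "blinfun_apply (\<Phi>' z) = (\<lambda>v. (fst v, ?N z \<bullet> v))" for z
    unfolding \<Phi>'_def by (rule bounded_linear_Blinfun_apply[OF bl])
  \<comment> \<open>The inverse of the derivative of \<Phi> at z0: the first components are kept and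
    the last one is solved for, which uses that the last component of the gradient is
    nonzero.\<close>
  define inv0 where "inv0 = Blinfun (\<lambda>v. (fst v, (snd v - fst (?N z0) \<bullet> fst v) / snd (?N z0)))"
  have inv0: "blinfun_apply inv0 = (\<lambda>v. (fst v, (snd v - fst (?N z0) \<bullet> fst v) / snd (?N z0)))"
    unfolding inv0_def divide_inverse
    by (intro bounded_linear_Blinfun_apply bounded_linear_intros bounded_linear_mult_const bounded_linear_sub)
  have "open U" unfolding U_def
    by (intro open_Collect_neq continuous_intros cont)
  have "(\<Phi> has_derivative blinfun_apply (\<Phi>' z)) (at z)" for z
    unfolding \<Phi>_def \<Phi>' by (auto intro!: derivative_eq_intros der)
  moreover have "continuous_on U \<Phi>'"
    by (rule continuous_on_blinfun_componentwise)
       (auto simp: \<Phi>' intro!: continuous_intros continuous_on_subset[OF cont])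
  moreover have "inv0 o\<^sub>L \<Phi>' z0 = id_blinfun"
    by (rule blinfun_eqI) (use z0(2) in \<open>auto simp: \<Phi>' inv0 inner_prod_def\<close>)
  moreover have "z0 \<in> U" using z0 by (simp add: U_def)
  ultimately obtain G V g g' where G: "open G" "G \<subseteq> U" "z0 \<in> G" "open V" "\<Phi> z0 \<in> V"
      "homeomorphism G V \<Phi> g" "\<And>y. y \<in> V \<Longrightarrow> (g has_derivative (g' y)) (at y)"
    using inverse_function_theorem[OF \<open>open U\<close>, of \<Phi> \<Phi>' z0 inv0] by metis
  define D where "D = {u. (u, 0) \<in> V}"
  define \<phi> where "\<phi> = (\<lambda>u. g (u, 0::real))"
  have openD: "open D"
  proof -
    have "D = (\<lambda>u. (u, 0::real)) -` V" by (auto simp: D_def)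
    then show ?thesis using \<open>open V\<close> by (auto intro!: open_vimage continuous_intros)
  qed
  have \<phi>: "\<phi> u \<in> G" "fst (\<phi> u) = u" "\<psi> (\<phi> u) = 0" if "u \<in> D" for u
  proof -
    have "(u, 0) \<in> V" using that by (simp add: D_def)
    then have "\<Phi> (g (u, 0)) = (u, 0)" "g (u, 0) \<in> G"
      using G(6) by (auto simp: homeomorphism_def)
    then show "\<phi> u \<in> G" "fst (\<phi> u) = u" "\<psi> (\<phi> u) = 0" by (auto simp: \<Phi>_def \<phi>_def)
  qed
  have inv: "fst z \<in> D \<and> \<phi> (fst z) = z" if "z \<in> G" "\<psi> z = 0" for z
  proof -
    have "\<Phi> z = (fst z, 0)" using that by (simp add: \<Phi>_def)
    then show ?thesis using G(6) that(1) by (force simp: homeomorphism_def D_def \<phi>_def)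
  qed
  have d: "(\<phi> has_derivative (\<lambda>h. (h, - (1 / snd (?N (\<phi> u))) *\<^sub>R fst (?N (\<phi> u)) \<bullet> h))) (at u)"
    if u: "u \<in> D" for u
  proof -
    \<comment> \<open>The theorem leaves g' abstract. L is recovered from the two identities fst
      (\<phi> u) = u and \<psi> (\<phi> u) = 0 by uniqueness of derivatives.\<close>
    define L where "L = (\<lambda>h. g' (u, 0) (h, 0))"
    have L: "(\<phi> has_derivative L) (at u)"
      unfolding \<phi>_def L_def
      by (rule has_derivative_compose[where f = "\<lambda>u. (u, 0)" and f' = "\<lambda>h. (h, 0)"])
         (use u in \<open>auto simp: D_def intro!: derivative_eq_intros G(7)\<close>)
    have "((\<lambda>u. fst (\<phi> u)) has_derivative (\<lambda>h. fst (L h))) (at u)"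
      using L by (rule has_derivative_fst)
    moreover have "((\<lambda>u. fst (\<phi> u)) has_derivative (\<lambda>h. h)) (at u)"
      by (rule has_derivative_transform_within_open[OF has_derivative_ident openD u]) (simp add: \<phi>)
    ultimately have f: "fst (L h) = h" for h using has_derivative_unique by metis
    have "((\<lambda>u. \<psi> (\<phi> u)) has_derivative (\<lambda>h. ?N (\<phi> u) \<bullet> L h)) (at u)"
      by (rule has_derivative_compose[OF L, where g' = "\<lambda>v. ?N (\<phi> u) \<bullet> v"]) (rule der)
    moreover have "((\<lambda>u. \<psi> (\<phi> u)) has_derivative (\<lambda>h. 0)) (at u)"
      by (rule has_derivative_transform_within_open[OF has_derivative_const openD u]) (simp add: \<phi>)
    ultimately have n: "?N (\<phi> u) \<bullet> L h = 0" for h using has_derivative_unique by metis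
    have "snd (?N (\<phi> u)) \<noteq> 0" using \<phi>(1)[OF u] G(2) by (auto simp: U_def)
    then have "L = (\<lambda>h. (h, - (1 / snd (?N (\<phi> u))) *\<^sub>R fst (?N (\<phi> u)) \<bullet> h))"
      using inner_eq_0_imp_graph[OF n] by (simp add: f fun_eq_iff)
    with L show ?thesis by simp
  qed
  have c: "continuous_on D \<phi>"
    using has_derivative_continuous[OF d] by (simp add: continuous_at_imp_continuous_on)
  have cN: "continuous_on D (\<lambda>u. ?N (\<phi> u))"
    by (rule continuous_on_compose2[OF cont c]) simp
  have "regular_parametrization {z. \<psi> z = 0} D \<phi>
       (\<lambda>u h. (h, - (1 / snd (?N (\<phi> u))) *\<^sub>R fst (?N (\<phi> u)) \<bullet> h))"
    unfolding regular_parametrization_def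
  proof (intro conjI ballI allI)
    show "inj_on \<phi> D" by (rule inj_on_inverseI[of _ fst]) (simp add: \<phi>)
    show "continuous_on D (\<lambda>u. (h, - (1 / snd (?N (\<phi> u))) *\<^sub>R fst (?N (\<phi> u)) \<bullet> h))" for h
      using \<phi>(1) G(2) by (intro continuous_intros cN) (auto simp: U_def)
  qed (use openD \<phi>(3) d in \<open>auto simp: inj_on_def\<close>)
  then show ?thesis
    using that[OF G(1,3)] inv[OF G(3) z0(1)] inv by blast
qed

lemma continuous_on_area_element:
  assumes "\<And>h. continuous_on D (\<lambda>u. \<phi>' u h)"
  shows "continuous_on D (\<lambda>u. area_element (\<phi>' u))"
  unfolding area_element_def det_def by (simp, intro continuous_intros assms)

lemma compact_image_in_sets_surface:
  assumes "is_surface_measure S \<tau>" "compact K" "K \<subseteq> S"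
  shows "K \<in> sets \<tau>"
proof -
  have "K \<in> sets borel" using assms(2) by (simp add: borel_compact)
  with assms(1,3) show ?thesis
    by (auto simp: is_surface_measure_def sets_restrict_space)
qed

text \<open>On a small neighbourhood the area element and the integrand are nearly constant, so the
  integral lies between products of constants and the Lebesgue measure of the parameter set. The
  sets and the filter are general because the lemma is applied both to balls of radius r and to
  balls of radius C r.\<close>

lemma set_integral_shrinking_compact:
  fixes \<tau> :: "((real^'n) \<times> real) measure" and h :: "(real^'n) \<times> real \<Rightarrow> real"
  assumes \<tau>: "is_surface_measure S \<tau>"
    and reg: "regular_parametrization S D \<phi> \<phi>'" and u0: "u0 \<in> D" and J0: "0 < area_element (\<phi>' u0)"
    and K: "\<forall>\<^sub>F r in F. compact (K r)" "\<And>d. 0 < d \<Longrightarrow> \<forall>\<^sub>F r in F. K r \<subseteq> ball u0 d"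
    and V: "\<forall>\<^sub>F r in F. \<phi> ` K r \<subseteq> V" "\<phi> u0 \<in> V"
    and h: "continuous_on V h" "set_integrable \<tau> V h" and e: "0 < e"
  shows "\<forall>\<^sub>F r in F. \<bar>(LINT z:\<phi> ` K r|\<tau>. h z) - h (\<phi> u0) * area_element (\<phi>' u0) * measure lborel (K r)\<bar>
      \<le> e * measure lborel (K r)"
proof -
  let ?J = "\<lambda>u. area_element (\<phi>' u)" and ?h0 = "h (\<phi> u0)"
  have reg': "open D" "inj_on \<phi> D" "\<phi> ` D \<subseteq> S" "\<And>u. u \<in> D \<Longrightarrow> (\<phi> has_derivative \<phi>' u) (at u)"
      "\<And>h. continuous_on D (\<lambda>u. \<phi>' u h)"
    using reg by (auto simp: regular_parametrization_def)
  have c\<phi>: "continuous_on D \<phi>"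
    using has_derivative_continuous[OF reg'(4)] by (simp add: continuous_at_imp_continuous_on)
  have cJ: "continuous_on D ?J" by (rule continuous_on_area_element[OF reg'(5)])
  \<comment> \<open>The oscillation allowed to area element and integrand: below J(u0), so that the
    lower bound stays positive, at most 1, so that the area is at most (J(u0) + 1) times the volume,
    and small enough for the total error e1 (J(u0) + 1 + |h0|).\<close>
  define e1 where "e1 = min (min 1 (?J u0 / 2)) (e / (?J u0 + 1 + \<bar>?h0\<bar>))"
  have e1: "0 < e1" "e1 \<le> 1" "e1 < ?J u0"
  proof -
    have "0 < e / (?J u0 + 1 + \<bar>?h0\<bar>)" using J0 e by (intro divide_pos_pos) auto
    then show "0 < e1" "e1 \<le> 1" "e1 < ?J u0"
      using J0 unfolding e1_def by linarith+
  qed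
  have e1': "e1 * (?J u0 + 1 + \<bar>?h0\<bar>) \<le> e"
  proof -
    have "e1 \<le> e / (?J u0 + 1 + \<bar>?h0\<bar>)" unfolding e1_def by simp
    then show ?thesis using J0 by (subst (asm) pos_le_divide_eq) auto
  qed
  obtain d0 where d0: "0 < d0" "ball u0 d0 \<subseteq> D" using reg'(1) u0 openE by blast
  obtain d1 where d1: "0 < d1" "\<And>u. u \<in> D \<Longrightarrow> dist u u0 < d1 \<Longrightarrow> dist (?J u) (?J u0) < e1"
    using cJ u0 e1(1) unfolding continuous_on_iff by meson
  obtain d2' where d2': "0 < d2'" "\<And>z. z \<in> V \<Longrightarrow> dist z (\<phi> u0) < d2' \<Longrightarrow> dist (h z) ?h0 < e1"
    using h(1) V(2) e1(1) unfolding continuous_on_iff by meson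
  obtain d2 where d2: "0 < d2" "\<And>u. u \<in> D \<Longrightarrow> dist u u0 < d2 \<Longrightarrow> dist (\<phi> u) (\<phi> u0) < d2'"
    using c\<phi> u0 d2'(1) unfolding continuous_on_iff by meson
  define d where "d = min d0 (min d1 d2)"
  have "0 < d" using d0 d1 d2 by (simp add: d_def)
  show ?thesis
    using K(1) K(2)[OF \<open>0 < d\<close>] V(1)
  proof eventually_elim
    case (elim r)
    let ?K = "K r" and ?A = "\<phi> ` K r" and ?m = "measure \<tau> (\<phi> ` K r)" and ?L = "measure lborel (K r)"
    have "ball u0 d \<subseteq> ball u0 d0" by (rule subset_ball) (simp add: d_def)
    then have KD: "?K \<subseteq> D" using elim(2) d0(2) by blast
    have Kb: "?K \<in> sets borel" using elim(1) by (simp add: borel_compact)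
    have J: "\<bar>?J u - ?J u0\<bar> < e1" if "u \<in> ?K" for u
      using d1(2)[of u] that KD elim(2) by (auto simp: dist_real_def d_def dist_commute subset_iff)
    have hA: "\<bar>h z - ?h0\<bar> < e1" if z: "z \<in> ?A" for z
    proof -
      obtain u where u: "u \<in> ?K" "z = \<phi> u" using z by blast
      have "dist (\<phi> u) (\<phi> u0) < d2'"
        using d2(2)[of u] u KD elim(2) by (auto simp: d_def dist_commute subset_iff)
      then show ?thesis using d2'(2)[of z] u elim(3) by (auto simp: dist_real_def)
    qed
    have "compact ?A"
      using elim(1) c\<phi> KD by (meson compact_continuous_image continuous_on_subset)
    then have As: "?A \<in> sets \<tau>"
      using compact_image_in_sets_surface[OF \<tau>] KD reg'(3) by blast
    have L: "emeasure lborel ?K = ennreal ?L"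
      using emeasure_compact_finite[OF elim(1)] by (simp add: emeasure_eq_ennreal_measure)
    have em: "emeasure \<tau> ?A = (\<integral>\<^sup>+u\<in>?K. ennreal (?J u) \<partial>lborel)"
      using \<tau> reg Kb KD by (auto simp: is_surface_measure_def)
    have "(\<integral>\<^sup>+u\<in>?K. ennreal (?J u) \<partial>lborel) \<le> (\<integral>\<^sup>+u. ennreal (?J u0 + e1) * indicator ?K u \<partial>lborel)"
      using J by (intro nn_integral_mono) (fastforce simp: indicator_def intro!: ennreal_leI)
    also have "\<dots> = ennreal ((?J u0 + e1) * ?L)"
      using Kb J0 e1 by (simp add: nn_integral_cmult_indicator L ennreal_mult)
    finally have up: "emeasure \<tau> ?A \<le> ennreal ((?J u0 + e1) * ?L)" by (simp add: em)
    have "ennreal ((?J u0 - e1) * ?L) = (\<integral>\<^sup>+u. ennreal (?J u0 - e1) * indicator ?K u \<partial>lborel)"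
      using Kb e1 by (simp add: nn_integral_cmult_indicator L ennreal_mult)
    also have "\<dots> \<le> (\<integral>\<^sup>+u\<in>?K. ennreal (?J u) \<partial>lborel)"
      using J by (intro nn_integral_mono) (fastforce simp: indicator_def intro!: ennreal_leI)
    finally have lo: "ennreal ((?J u0 - e1) * ?L) \<le> emeasure \<tau> ?A" by (simp add: em)
    \<comment> \<open>Finiteness of the area of the image comes from the upper bound just obtained;
      it is what allows integration of constants over the image.\<close>
    have fin: "emeasure \<tau> ?A \<noteq> \<infinity>" using up by (auto simp: top_unique)
    then have m: "emeasure \<tau> ?A = ennreal ?m" by (simp add: emeasure_eq_ennreal_measure)
    have mu: "?m \<le> (?J u0 + e1) * ?L" using up J0 e1 by (simp add: m)
    have ml: "(?J u0 - e1) * ?L \<le> ?m" using lo by (simp add: m)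
    have ih: "set_integrable \<tau> ?A h" using set_integrable_subset[OF h(2) As] elim(3) by blast
    have ic: "set_integrable \<tau> ?A (\<lambda>_. c)" for c :: real
      using As fin unfolding set_integrable_def by (simp add: less_top)
    have "(LINT z:?A|\<tau>. h z) \<le> (LINT z:?A|\<tau>. ?h0 + e1)"
      using hA by (intro set_integral_mono ih ic) force
    then have iu: "(LINT z:?A|\<tau>. h z) \<le> ?m * (?h0 + e1)"
      using set_integral_const[OF As fin, of "?h0 + e1"] unfolding real_scaleR_def by linarith
    have "(LINT z:?A|\<tau>. ?h0 - e1) \<le> (LINT z:?A|\<tau>. h z)"
      using hA by (intro set_integral_mono ih ic) force
    then have il: "?m * (?h0 - e1) \<le> (LINT z:?A|\<tau>. h z)"
      using set_integral_const[OF As fin, of "?h0 - e1"] unfolding real_scaleR_def by linarith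
    have "\<bar>(LINT z:?A|\<tau>. h z) - ?h0 * ?J u0 * ?L\<bar> \<le>
        \<bar>(LINT z:?A|\<tau>. h z) - ?h0 * ?m\<bar> + \<bar>?h0 * (?m - ?J u0 * ?L)\<bar>"
      by (simp add: algebra_simps)
    also have "\<dots> \<le> e1 * ?m + \<bar>?h0\<bar> * (e1 * ?L)"
    proof (rule add_mono)
      show "\<bar>(LINT z:?A|\<tau>. h z) - ?h0 * ?m\<bar> \<le> e1 * ?m"
        using iu il by (simp add: abs_le_iff algebra_simps)
      have "\<bar>?m - ?J u0 * ?L\<bar> \<le> e1 * ?L" using mu ml by (simp add: abs_le_iff algebra_simps)
      then show "\<bar>?h0 * (?m - ?J u0 * ?L)\<bar> \<le> \<bar>?h0\<bar> * (e1 * ?L)"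
        unfolding abs_mult by (intro mult_left_mono) auto
    qed
    also have "\<dots> \<le> e1 * ((?J u0 + 1) * ?L) + \<bar>?h0\<bar> * (e1 * ?L)"
    proof -
      have "?m \<le> (?J u0 + 1) * ?L" using e1(2) by (intro order_trans[OF mu] mult_right_mono) auto
      then show ?thesis using e1(1) by simp
    qed
    also have "\<dots> = (e1 * (?J u0 + 1 + \<bar>?h0\<bar>)) * ?L" by (simp add: algebra_simps)
    also have "\<dots> \<le> e * ?L" using e1' by (intro mult_right_mono) auto
    finally show ?case .
  qed
qed

lemma measure_lborel_cball_real:
  fixes c :: "real^'n"
  assumes "0 \<le> r"
  shows "measure lborel (cball c r) = unit_ball_vol CARD('n) * r ^ CARD('n)"
  using content_cball[OF assms, of c] by simp

lemma measure_lborel_cball_pos: "0 < r \<Longrightarrow> 0 < measure lborel (cball (c :: real^'n) r)"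
  by (simp add: measure_lborel_cball_real)

lemma eventually_cball_subset:
  assumes "open S" "x \<in> S"
  shows "\<forall>\<^sub>F r in at_right 0. cball x r \<subseteq> S"
proof -
  obtain d where d: "0 < d" "cball x d \<subseteq> S" using assms open_contains_cball by blast
  have "\<forall>\<^sub>F r in at_right 0. r < d" using d(1) by (intro eventually_at_rightI[of 0 d]) auto
  then show ?thesis by eventually_elim (use d in \<open>auto simp: subset_iff\<close>)
qed

lemma set_integral_shrinking_cball:
  fixes \<tau> :: "((real^'n) \<times> real) measure" and h :: "(real^'n) \<times> real \<Rightarrow> real"
  assumes \<tau>: "is_surface_measure S \<tau>"
    and reg: "regular_parametrization S D \<phi> \<phi>'" and u0: "u0 \<in> D" and J0: "0 < area_element (\<phi>' u0)"
    and V: "\<forall>\<^sub>F r in at_right 0. \<phi> ` cball u0 r \<subseteq> V" "\<phi> u0 \<in> V"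
    and h: "continuous_on V h" "set_integrable \<tau> V h"
  shows "((\<lambda>r. (LINT z:\<phi> ` cball u0 r|\<tau>. h z) / measure lborel (cball u0 r))
     \<longlongrightarrow> h (\<phi> u0) * area_element (\<phi>' u0)) (at_right 0)"
proof (rule tendstoI)
  fix e :: real assume "0 < e"
  then have e2: "0 < e / 2" by simp
  have 1: "\<forall>\<^sub>F r in at_right 0. compact (cball u0 r)" by simp
  have 2: "\<forall>\<^sub>F r in at_right 0. cball u0 r \<subseteq> ball u0 d" if "0 < d" for d
    by (rule eventually_cball_subset) (use that in auto)
  have ev: "\<forall>\<^sub>F r in at_right 0.
      \<bar>(LINT z:\<phi> ` cball u0 r|\<tau>. h z) - h (\<phi> u0) * area_element (\<phi>' u0) * measure lborel (cball u0 r)\<bar>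
      \<le> e / 2 * measure lborel (cball u0 r)"
    by (rule set_integral_shrinking_compact[OF \<tau> reg u0 J0 1 _ V h e2]) (rule 2)
  have 3: "\<forall>\<^sub>F r in at_right (0::real). 0 < r" by (simp add: eventually_at_right_less)
  show "\<forall>\<^sub>F r in at_right 0. dist ((LINT z:\<phi> ` cball u0 r|\<tau>. h z) / measure lborel (cball u0 r))
     (h (\<phi> u0) * area_element (\<phi>' u0)) < e"
    using ev 3
  proof eventually_elim
    case (elim r)
    have L: "0 < measure lborel (cball u0 r)" using elim(2) by (rule measure_lborel_cball_pos)
    have "dist ((LINT z:\<phi> ` cball u0 r|\<tau>. h z) / measure lborel (cball u0 r)) (h (\<phi> u0) * area_element (\<phi>' u0))
       = \<bar>(LINT z:\<phi> ` cball u0 r|\<tau>. h z) - h (\<phi> u0) * area_element (\<phi>' u0) * measure lborel (cball u0 r)\<bar>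
          / measure lborel (cball u0 r)"
    proof -
      have "\<bar>a / l - b\<bar> = \<bar>a - b * l\<bar> / l" if "0 < l" for a b l :: real
      proof -
        have "a / l - b = (a - b * l) / l" using that by (simp add: field_simps)
        then show ?thesis using that by (simp add: abs_divide)
      qed
      from this[OF L] show ?thesis unfolding dist_real_def .
    qed
    also have "\<dots> \<le> e / 2" using elim(1) L by (simp add: pos_divide_le_eq)
    also have "\<dots> < e" using \<open>0 < e\<close> by simp
    finally show ?case .
  qed
qed

section \<open>Images of small balls under maps into a hypersurface\<close>

lemma area_element_graph_pos:
  fixes T :: "real^'n^'n"
  assumes "det T \<noteq> 0" "\<And>h. L h = (T *v h, w \<bullet> (T *v h))"
  shows "0 < area_element L"
  using assms(1) by (simp add: area_element_graph[OF assms(2)] add_pos_nonneg)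

text \<open>A map whose derivative is continuous in operator norm and invertible at x0 is injective
  near x0. This is applied to the first component of Z, whose injectivity implies that of Z.\<close>

lemma regular_parametrization_near:
  fixes Z :: "real^'n \<Rightarrow> (real^'n) \<times> real" and A :: "real^'n \<Rightarrow> real^'n^'n"
  assumes W: "open W" "x0 \<in> W" "Z ` W \<subseteq> S"
    and Z: "\<And>x. x \<in> W \<Longrightarrow> (Z has_derivative (\<lambda>h. (A x *v h, w x \<bullet> (A x *v h)))) (at x)"
    and cA: "continuous_on W A" and cw: "continuous_on W w" and det: "det (A x0) \<noteq> 0"
  obtains D where "x0 \<in> D" "regular_parametrization S D Z (\<lambda>x h. (A x *v h, w x \<bullet> (A x *v h)))"
proof -
  define W1 where "W1 = {x \<in> W. det (A x) \<noteq> 0}"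
  have "W1 = W \<inter> (\<lambda>x. det (A x)) -` (- {0})" by (auto simp: W1_def)
  then have W1: "open W1" "x0 \<in> W1"
    using continuous_open_preimage[OF continuous_on_det[OF cA] W(1), of "- {0}"] W(2) det
    by (auto simp: W1_def)
  have fZ: "((\<lambda>x. fst (Z x)) has_derivative (*v) (A x)) (at x)" if "x \<in> W1" for x
    using has_derivative_fst[OF Z, of x] that by (simp add: W1_def)
  have on: "\<exists>d>0. \<forall>x. dist x0 x < d \<longrightarrow> onorm (\<lambda>v. A x *v v - A x0 *v v) < e" if "0 < e" for e
  proof -
    \<comment> \<open>The operator norm is at most n^2 times a bound of the entries; the extra
      factor 2 gives a strict inequality.\<close>
    define e1 where "e1 = e / (real CARD('n) * real CARD('n) * 2)"
    have "0 < e1" using that by (simp add: e1_def)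
    have "isCont A x0" using cA W by (simp add: continuous_on_eq_continuous_at)
    then obtain d where d: "0 < d" "\<And>x. dist x x0 < d \<Longrightarrow> dist (A x) (A x0) < e1"
      using \<open>0 < e1\<close> unfolding continuous_at_eps_delta by metis
    have "onorm (\<lambda>v. A x *v v - A x0 *v v) < e" if "dist x0 x < d" for x
    proof -
      have "\<bar>(A x - A x0) $ i $ j\<bar> \<le> e1" for i j
      proof -
        have "\<bar>(A x - A x0) $ i $ j\<bar> \<le> norm ((A x - A x0) $ i)" by (rule component_le_norm_cart)
        also have "\<dots> \<le> norm (A x - A x0)" by (rule Finite_Cartesian_Product.norm_nth_le)
        also have "\<dots> < e1" using d(2)[of x] that by (simp add: dist_norm[symmetric] dist_commute)
        finally show ?thesis by simp
      qed
      then have "onorm ((*v) (A x - A x0)) \<le> real CARD('n) * real CARD('n) * e1"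
        by (rule onorm_le_matrix_component)
      also have "\<dots> = e / 2" by (simp add: e1_def)
      also have "\<dots> < e" using \<open>0 < e\<close> by simp
      finally have "onorm ((*v) (A x - A x0)) < e" .
      moreover have "(*v) (A x - A x0) = (\<lambda>v. A x *v v - A x0 *v v)"
        by (simp add: fun_eq_iff matrix_vector_mult_diff_rdistrib)
      ultimately show ?thesis by simp
    qed
    with d(1) show ?thesis by blast
  qed
  have gf: "(*v) (matrix_inv (A x0)) \<circ> (*v) (A x0) = id"
    using det by (simp add: fun_eq_iff matrix_vector_mul_assoc matrix_inv_left invertible_det_nz)
  obtain r where r: "0 < r" "ball x0 r \<subseteq> W1" "inj_on (\<lambda>x. fst (Z x)) (ball x0 r)"
    by (rule has_derivative_locally_injective[where f' = "\<lambda>x. (*v) (A x)", OF W1(2,1) _ gf fZ on])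
       (use matrix_vector_mul_bounded_linear in blast)+
  have rW: "ball x0 r \<subseteq> W" using r(2) by (auto simp: W1_def)
  have "regular_parametrization S (ball x0 r) Z (\<lambda>x h. (A x *v h, w x \<bullet> (A x *v h)))"
    unfolding regular_parametrization_def
  proof (intro conjI ballI allI)
    show "inj_on Z (ball x0 r)" using r(3) by (auto simp: inj_on_def)
    show "Z ` ball x0 r \<subseteq> S" using W(3) rW by blast
    show "(Z has_derivative (\<lambda>h. (A u *v h, w u \<bullet> (A u *v h)))) (at u)" if "u \<in> ball x0 r" for u
      using Z that rW by blast
    show "inj (\<lambda>h. (A u *v h, w u \<bullet> (A u *v h)))" if "u \<in> ball x0 r" for u
    proof (rule injI)
      fix h k assume "(A u *v h, w u \<bullet> (A u *v h)) = (A u *v k, w u \<bullet> (A u *v k))"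
      then have "matrix_inv (A u) *v (A u *v h) = matrix_inv (A u) *v (A u *v k)" by simp
      moreover have "invertible (A u)" using that r(2) by (auto simp: W1_def invertible_det_nz)
      ultimately show "h = k" by (simp add: matrix_vector_mul_assoc matrix_inv_left)
    qed
    show "continuous_on (ball x0 r) (\<lambda>u. (A u *v h, w u \<bullet> (A u *v h)))" for h
      unfolding matrix_vector_mult_def
      by (intro continuous_intros continuous_on_vec_lambda continuous_on_subset[OF cA rW] continuous_on_subset[OF cw rW])
  qed simp
  then show ?thesis using that r(1) by (meson centre_in_ball)
qed

text \<open>A unit vector in the kernel of the transpose. It provides the thin direction of the
  plate in the degenerate case.\<close>

lemma det_zero_imp_range_orthogonal:
  fixes A :: "real^'n^'n"
  assumes "det A = 0"
  obtains e where "norm e = 1" "\<And>h. e \<bullet> (A *v h) = 0"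
proof -
  have "det (transpose A) = 0" using assms by simp
  then obtain y where y: "y \<noteq> 0" "transpose A *v y = 0"
    using matrix_left_invertible_ker[of "transpose A"] invertible_left_inverse invertible_det_nz by metis
  have "(y /\<^sub>R norm y) \<bullet> (A *v h) = 0" for h
    using dot_lmul_matrix[of y A h] y(2) by simp
  moreover have "norm (y /\<^sub>R norm y) = 1" using y(1) by simp
  ultimately show ?thesis using that by blast
qed

lemma set_integral_mono_set_nonneg:
  fixes h :: "'a \<Rightarrow> real"
  assumes "set_integrable M B h" "A \<in> sets M" "A \<subseteq> B" "\<And>z. z \<in> B \<Longrightarrow> 0 \<le> h z"
  shows "(LINT z:A|M. h z) \<le> (LINT z:B|M. h z)"
proof -
  have "set_integrable M A h" using set_integrable_subset[OF assms(1-3)] .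
  then show ?thesis
    using assms unfolding set_lebesgue_integral_def set_integrable_def
    by (intro integral_mono) (auto simp: indicator_def)
qed

text \<open>If the Jacobian vanishes at \<open>x\<^sub>0\<close>, then \<open>Z\<close> maps the ball of radius \<open>r\<close> into the image under
  the chart of a plate of diameter \<open>O(r)\<close> and thickness \<open>\<epsilon> r\<close>. The plate is itself the image of a ball under the
  linear map \<open>T\<close> below with determinant \<open>\<epsilon>\<close>, so that its area can be read off from the
  parametrization \<open>\<phi> \<circ> T\<close>.\<close>

lemma set_integral_image_degenerate:
  fixes \<tau> :: "((real^'n) \<times> real) measure" and h :: "(real^'n) \<times> real \<Rightarrow> real"
    and Z :: "real^'n \<Rightarrow> (real^'n) \<times> real" and A :: "real^'n^'n"
  assumes \<tau>: "is_surface_measure S \<tau>" and V: "openin (top_of_set S) V"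
    and h: "continuous_on V h" "set_integrable \<tau> V h" "\<And>z. z \<in> V \<Longrightarrow> 0 \<le> h z"
    and W: "open W" "x0 \<in> W" "Z ` W \<subseteq> V" "continuous_on W Z"
    and dz: "((\<lambda>x. fst (Z x)) has_derivative (*v) A) (at x0)" and det: "det A = 0"
    and reg: "regular_parametrization S D \<phi> (\<lambda>u k. (k, v u \<bullet> k))"
    and chart: "fst (Z x0) \<in> D" "\<forall>\<^sub>F x in nhds x0. \<phi> (fst (Z x)) = Z x"
  shows "((\<lambda>r. (LINT z:Z ` cball x0 r|\<tau>. h z) / measure lborel (cball x0 r)) \<longlongrightarrow> 0) (at_right 0)"
proof (rule tendstoI)
  fix e :: real assume "0 < e"
  have reg': "open D" "inj_on \<phi> D" "\<phi> ` D \<subseteq> S"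
      "\<And>u. u \<in> D \<Longrightarrow> (\<phi> has_derivative (\<lambda>k. (k, v u \<bullet> k))) (at u)"
      "\<And>k. continuous_on D (\<lambda>u. (k, v u \<bullet> k))"
    using reg by (auto simp: regular_parametrization_def)
  have cv: "continuous_on D (\<lambda>u. v u \<bullet> k)" for k
    using continuous_on_snd[OF reg'(5), of k] by simp
  define z0 where "z0 = fst (Z x0)"
  have \<phi>0: "\<phi> z0 = Z x0" using eventually_nhds_x_imp_x[OF chart(2)] by (simp add: z0_def)
  obtain n where n: "norm n = 1" "\<And>k. n \<bullet> (A *v k) = 0"
    using det_zero_imp_range_orthogonal[OF det] by blast
  have nn: "n \<bullet> n = 1" using n(1) by (simp add: dot_square_norm)
  obtain K where K: "0 < K" "\<And>k. norm (A *v k) \<le> norm k * K"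
    using bounded_linear.pos_bounded[OF matrix_vector_mul_bounded_linear[of A]] by blast
  \<comment> \<open>The preimage of Z(\<open>cball x0 r\<close>) under the plate's parametrization
    has radius at most (K + 1) r: K r from the linear part, \<epsilon> r from the remainder, and r -
    \<epsilon> r from stretching the remainder back along n.\<close>
  define C where "C = K + 2"
  define J where "J = sqrt (1 + v z0 \<bullet> v z0)"
  have "0 < J" by (simp add: J_def add_pos_nonneg)
  let ?h0 = "h (Z x0)"
  have h0: "0 \<le> ?h0" using h(3) W(2,3) by blast
  \<comment> \<open>The integral over the plate is at most \<epsilon> (h0 J + 1) times the volume of
    the ball of radius C r, that is \<epsilon> M times the volume of the ball of radius r. The
    number \<epsilon> serves both as thickness and as error tolerance.\<close>
  define M where "M = (?h0 * J + 1) * C ^ CARD('n)"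
  have "0 < M" using h0 K(1) \<open>0 < J\<close> by (auto simp: M_def C_def add_nonneg_pos)
  define \<epsilon> where "\<epsilon> = min 1 (e / (2 * M))"
  have \<epsilon>: "0 < \<epsilon>" "\<epsilon> \<le> 1" "\<epsilon> * M < e"
  proof -
    show "0 < \<epsilon>" "\<epsilon> \<le> 1" using \<open>0 < e\<close> \<open>0 < M\<close> by (auto simp: \<epsilon>_def)
    have "\<epsilon> * M \<le> e / (2 * M) * M" using \<open>0 < M\<close> by (intro mult_right_mono) (auto simp: \<epsilon>_def)
    also have "\<dots> < e" using \<open>0 < e\<close> \<open>0 < M\<close> by simp
    finally show "\<epsilon> * M < e" .
  qed
  \<comment> \<open>T compresses the direction n by the factor \<epsilon> and fixes its orthogonal
    complement, which contains the range of A; hence T A = A.\<close>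
  define T :: "real^'n^'n" where "T = mat 1 + outer ((\<epsilon> - 1) *\<^sub>R n) n"
  have detT: "det T = \<epsilon>" by (simp add: T_def det_id_plus_outer nn)
  have T: "T *v k = k + ((\<epsilon> - 1) * (n \<bullet> k)) *\<^sub>R n" for k
    by (simp add: T_def matrix_vector_mult_add_rdistrib outer_mult_vec mult.commute)
  define D' where "D' = {u. z0 + T *v u \<in> D}"
  define \<zeta> where "\<zeta> = (\<lambda>u. \<phi> (z0 + T *v u))"
  define \<zeta>' where "\<zeta>' = (\<lambda>u k. (T *v k, v (z0 + T *v u) \<bullet> (T *v k)))"
  have d\<zeta>: "(\<zeta> has_derivative \<zeta>' u) (at u)" if "u \<in> D'" for u
    unfolding \<zeta>_def \<zeta>'_def
    by (rule has_derivative_compose[where f' = "\<lambda>k. T *v k" and g' = "\<lambda>k. (k, v (z0 + T *v u) \<bullet> k)"])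
       (use that in \<open>auto simp: D'_def intro!: derivative_eq_intros reg'(4)
            bounded_linear_imp_has_derivative[OF matrix_vector_mul_bounded_linear]\<close>)
  have injT: "k = l" if "T *v k = T *v l" for k l
  proof -
    have "matrix_inv T *v (T *v k) = matrix_inv T *v (T *v l)" using that by simp
    then show ?thesis using detT \<epsilon>(1)
      by (simp add: matrix_vector_mul_assoc matrix_inv_left invertible_det_nz)
  qed
  have cT: "continuous_on B (\<lambda>u. z0 + T *v u)" for B by (intro continuous_intros)
  have openD': "open D'"
  proof -
    have "D' = (\<lambda>u. z0 + T *v u) -` D" by (auto simp: D'_def)
    then show ?thesis using reg'(1) cT by (simp add: open_vimage)
  qed
  have reg\<zeta>: "regular_parametrization S D' \<zeta> \<zeta>'"
    unfolding regular_parametrization_def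
  proof (intro conjI ballI allI)
    show "inj_on \<zeta> D'"
      using reg'(2) injT by (fastforce simp: inj_on_def \<zeta>_def D'_def)
    show "inj (\<zeta>' u)" for u using injT by (auto simp: inj_def \<zeta>'_def)
    show "continuous_on D' (\<lambda>u. \<zeta>' u k)" for k
      unfolding \<zeta>'_def
      by (intro continuous_intros continuous_on_compose2[OF cv cT]) (auto simp: D'_def)
  qed (use openD' d\<zeta> reg'(3) in \<open>auto simp: D'_def \<zeta>_def\<close>)
  have 0: "0 \<in> D'" "\<zeta> 0 = Z x0" using chart(1) \<phi>0 by (simp_all add: D'_def \<zeta>_def z0_def)
  have area: "area_element (\<zeta>' 0) = \<epsilon> * J"
    using area_element_graph[of "\<zeta>' 0" T "v z0"] detT \<epsilon>(1) by (simp add: \<zeta>'_def J_def)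
  obtain O' where O': "open O'" "V = S \<inter> O'" using V openin_open by blast
  have c\<zeta>: "continuous_on D' \<zeta>"
    using has_derivative_continuous[OF d\<zeta>] by (simp add: continuous_at_imp_continuous_on)
  have oV: "open (D' \<inter> \<zeta> -` O')" by (rule continuous_open_preimage[OF c\<zeta> openD' O'(1)])
  have ZV: "Z x0 \<in> V" using W(2,3) by blast
  then have zV: "0 \<in> D' \<inter> \<zeta> -` O'" using 0 O'(2) by auto
  \<comment> \<open>The substitution r \<mapsto> C r preserves the limit at 0 from the
    right.\<close>
  have sC: "\<forall>\<^sub>F r in at_right 0. cball 0 (C * r) \<subseteq> Q" if "open Q" "0 \<in> Q" for Q :: "(real^'n) set"
  proof -
    have "filterlim (\<lambda>r. C * r) (at_right 0) (at_right 0)"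
      unfolding filterlim_at using K(1)
      by (auto simp: C_def eventually_at_right_less intro!: tendsto_eq_intros
            eventually_mono[OF eventually_at_right_less])
    from filterlim_iff[THEN iffD1, OF this] eventually_cball_subset[OF that] show ?thesis by blast
  qed
  have ev1: "\<forall>\<^sub>F r in at_right 0. \<zeta> ` cball 0 (C * r) \<subseteq> V"
  proof -
    have *: "\<zeta> ` D' \<subseteq> S" using reg\<zeta> by (simp add: regular_parametrization_def)
    show ?thesis by (rule eventually_mono[OF sC[OF oV zV]]) (use * O'(2) in blast)
  qed
  have "\<forall>\<^sub>F r in at_right 0. \<bar>(LINT z:\<zeta> ` cball 0 (C * r)|\<tau>. h z)
       - h (\<zeta> 0) * area_element (\<zeta>' 0) * measure lborel (cball (0::real^'n) (C * r))\<bar>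
      \<le> \<epsilon> * measure lborel (cball (0::real^'n) (C * r))"
    by (rule set_integral_shrinking_compact[OF \<tau> reg\<zeta> 0(1) _ _ _ ev1 _ h(1,2) \<epsilon>(1)])
       (use \<epsilon>(1) \<open>0 < J\<close> ZV 0 sC in \<open>auto simp: area\<close>)
  then have ev2: "\<forall>\<^sub>F r in at_right 0. \<bar>(LINT z:\<zeta> ` cball 0 (C * r)|\<tau>. h z)
       - ?h0 * (\<epsilon> * J) * measure lborel (cball (0::real^'n) (C * r))\<bar>
      \<le> \<epsilon> * measure lborel (cball (0::real^'n) (C * r))"
    by (simp add: area 0(2))
  obtain d1 where d1: "0 < d1" "\<And>y. norm (y - x0) < d1 \<Longrightarrow>
      norm (fst (Z y) - fst (Z x0) - A *v (y - x0)) \<le> \<epsilon> * norm (y - x0)"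
    using dz[unfolded has_derivative_at_alt] \<epsilon>(1) by metis
  obtain N where N: "open N" "x0 \<in> N" "\<And>x. x \<in> N \<Longrightarrow> \<phi> (fst (Z x)) = Z x"
    using chart(2) unfolding eventually_nhds by blast
  have "open (ball x0 d1 \<inter> N \<inter> W)" "x0 \<in> ball x0 d1 \<inter> N \<inter> W"
    using d1 N W by auto
  from eventually_cball_subset[OF this]
  have ev3: "\<forall>\<^sub>F r in at_right 0. cball x0 r \<subseteq> ball x0 d1 \<inter> N \<inter> W" .
  have ev4: "\<forall>\<^sub>F r in at_right (0::real). 0 < r" by (simp add: eventually_at_right_less)
  show "\<forall>\<^sub>F r in at_right 0. dist ((LINT z:Z ` cball x0 r|\<tau>. h z) / measure lborel (cball x0 r)) 0 < e"
    using ev1 ev2 ev3 ev4 sC[OF openD' 0(1)]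
  proof eventually_elim
    case (elim r)
    let ?B = "\<zeta> ` cball 0 (C * r)" and ?L = "measure lborel (cball x0 r)"
    have sub: "Z ` cball x0 r \<subseteq> ?B"
    proof (rule image_subsetI)
      fix x assume x: "x \<in> cball x0 r"
      define k where "k = x - x0"
      define \<omega> where "\<omega> = fst (Z x) - z0 - A *v k"
      \<comment> \<open>This is the inverse of T applied to A k + \<omega>: only the n-component,
        which comes from \<omega> alone, is divided by \<epsilon>. As \<omega> is at most \<epsilon>
        r, the quotient is still O(r).\<close>
      define c where "c = A *v k + \<omega> + ((1 / \<epsilon> - 1) * (n \<bullet> \<omega>)) *\<^sub>R n"
      have kr: "norm k \<le> r" using x by (simp add: k_def dist_norm norm_minus_commute)
      have "norm \<omega> \<le> \<epsilon> * norm k"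
        using d1(2)[of x] elim(3) x by (auto simp: \<omega>_def z0_def k_def subset_iff dist_norm norm_minus_commute)
      also have "\<dots> \<le> \<epsilon> * r" using kr \<epsilon>(1) by simp
      finally have \<omega>: "norm \<omega> \<le> \<epsilon> * r" .
      have "\<bar>n \<bullet> \<omega>\<bar> \<le> \<epsilon> * r" using Cauchy_Schwarz_ineq2[of n \<omega>] n(1) \<omega> by simp
      then have "\<bar>(1 / \<epsilon> - 1) * (n \<bullet> \<omega>)\<bar> \<le> (1 / \<epsilon> - 1) * (\<epsilon> * r)"
        using \<epsilon>(1,2) unfolding abs_mult by (intro mult_mono) auto
      also have "\<dots> = r - \<epsilon> * r" using \<epsilon>(1) by (simp add: field_simps)
      finally have *: "\<bar>(1 / \<epsilon> - 1) * (n \<bullet> \<omega>)\<bar> \<le> r - \<epsilon> * r" .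
      have "norm c \<le> norm (A *v k) + norm \<omega> + \<bar>(1 / \<epsilon> - 1) * (n \<bullet> \<omega>)\<bar> * norm n"
        unfolding c_def by (rule order_trans[OF norm_triangle_ineq add_mono[OF norm_triangle_ineq]]) simp
      also have "\<dots> \<le> r * K + \<epsilon> * r + (r - \<epsilon> * r)"
        unfolding n(1) mult_1_right
        using K(1) by (intro add_mono order_trans[OF K(2) mult_right_mono[OF kr]] \<omega> *) simp
      also have "\<dots> \<le> C * r" using elim(4) by (simp add: C_def algebra_simps)
      finally have "c \<in> cball 0 (C * r)" by simp
      moreover have "T *v c = A *v k + \<omega>"
      proof -
        have "n \<bullet> c = (n \<bullet> \<omega>) / \<epsilon>"
          using nn n(2) by (simp add: c_def inner_add_right algebra_simps)
        then have "(\<epsilon> - 1) * (n \<bullet> c) = - ((1 / \<epsilon> - 1) * (n \<bullet> \<omega>))"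
          using \<epsilon>(1) by (simp add: field_simps)
        then show ?thesis unfolding T by (simp add: c_def)
      qed
      then have "\<zeta> c = \<phi> (fst (Z x))" by (simp add: \<zeta>_def \<omega>_def)
      then have "\<zeta> c = Z x" using N(3)[of x] elim(3) x by (auto simp: subset_iff)
      ultimately show "Z x \<in> ?B" by (metis imageI)
    qed
    have ZV': "Z ` cball x0 r \<subseteq> V" and VS: "V \<subseteq> S" using elim(3) W(3) O'(2) by blast+
    have "continuous_on (cball x0 r) Z" using elim(3) by (intro continuous_on_subset[OF W(4)]) auto
    then have "compact (Z ` cball x0 r)" by (intro compact_continuous_image) auto
    then have A: "Z ` cball x0 r \<in> sets \<tau>"
      using compact_image_in_sets_surface[OF \<tau>] ZV' VS by blast
    have "compact ?B"
      using elim(5) by (intro compact_continuous_image continuous_on_subset[OF c\<zeta>]) auto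
    then have B: "?B \<in> sets \<tau>"
      using compact_image_in_sets_surface[OF \<tau>] elim(1) VS by blast
    have iB: "set_integrable \<tau> ?B h" using set_integrable_subset[OF h(2) B elim(1)] .
    have L: "0 < ?L" using elim(4) by (rule measure_lborel_cball_pos)
    have LC: "measure lborel (cball (0::real^'n) (C * r)) = C ^ CARD('n) * ?L"
      using elim(4) K(1) by (simp add: C_def measure_lborel_cball_real power_mult_distrib)
    have "(LINT z:Z ` cball x0 r|\<tau>. h z) \<le> (LINT z:?B|\<tau>. h z)"
      by (rule set_integral_mono_set_nonneg[OF iB A sub]) (use elim(1) h(3) in blast)
    also have "\<dots> \<le> \<epsilon> * M * ?L"
      using elim(2) unfolding LC by (simp add: M_def abs_le_iff algebra_simps)
    also have "\<dots> < e * ?L" using \<epsilon>(3) L by simp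
    finally have "(LINT z:Z ` cball x0 r|\<tau>. h z) / ?L < e" using L by (simp add: pos_divide_less_eq)
    moreover have "0 \<le> (LINT z:Z ` cball x0 r|\<tau>. h z)"
      unfolding set_lebesgue_integral_def using ZV' h(3)
      by (intro integral_nonneg_AE AE_I2) (auto simp: indicator_def)
    ultimately show ?case using L by simp
  qed
qed

text \<open>One formula covers both cases, because the factor |det| is zero exactly when the image
  of the ball has area of smaller order.\<close>

lemma set_integral_image_cball_limit:
  fixes \<tau> :: "((real^'n) \<times> real) measure" and h :: "(real^'n) \<times> real \<Rightarrow> real"
    and Z :: "real^'n \<Rightarrow> (real^'n) \<times> real" and A :: "real^'n \<Rightarrow> real^'n^'n"
  assumes \<tau>: "is_surface_measure S \<tau>" and V: "openin (top_of_set S) V"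
    and h: "continuous_on V h" "set_integrable \<tau> V h" "\<And>z. z \<in> V \<Longrightarrow> 0 \<le> h z"
    and W: "open W" "x0 \<in> W" "Z ` W \<subseteq> V"
    and Z: "\<And>x. x \<in> W \<Longrightarrow> (Z has_derivative (\<lambda>k. (A x *v k, w x \<bullet> (A x *v k)))) (at x)"
    and cA: "continuous_on W A" and cw: "continuous_on W w"
    and reg: "regular_parametrization S D \<phi> (\<lambda>u k. (k, v u \<bullet> k))"
    and chart: "fst (Z x0) \<in> D" "\<forall>\<^sub>F x in nhds x0. \<phi> (fst (Z x)) = Z x"
  shows "((\<lambda>r. (LINT z:Z ` cball x0 r|\<tau>. h z) / measure lborel (cball x0 r))
    \<longlongrightarrow> h (Z x0) * (\<bar>det (A x0)\<bar> * sqrt (1 + w x0 \<bullet> w x0))) (at_right 0)"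
proof (cases "det (A x0) = 0")
  case True
  have "continuous_on W Z"
    using has_derivative_continuous[OF Z] by (simp add: continuous_at_imp_continuous_on)
  moreover have "((\<lambda>x. fst (Z x)) has_derivative (*v) (A x0)) (at x0)"
    using has_derivative_fst[OF Z[OF W(2)]] by simp
  ultimately show ?thesis
    using set_integral_image_degenerate[OF \<tau> V h W _ _ True reg chart] True by simp
next
  case False
  have "Z ` W \<subseteq> S" using W(3) V openin_subset by fastforce
  then obtain D1 where D1: "x0 \<in> D1" "regular_parametrization S D1 Z (\<lambda>x h. (A x *v h, w x \<bullet> (A x *v h)))"
    using regular_parametrization_near[OF W(1,2) _ Z cA cw False] by blast
  have "\<forall>\<^sub>F r in at_right 0. Z ` cball x0 r \<subseteq> V"
    using eventually_cball_subset[OF W(1,2)] by eventually_elim (use W(3) in blast)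
  from set_integral_shrinking_cball[OF \<tau> D1(2,1) area_element_graph_pos[OF False refl] this _ h(1,2)] W(2,3)
  show ?thesis by (auto simp: area_element_graph[OF refl])
qed

section \<open>The map from the emitter to the receiver\<close>

lemma hemi_has_derivative:
  assumes "norm x < 1"
  shows "(hemi has_derivative (\<lambda>h. (h, - (x \<bullet> h) / snd (hemi x)))) (at x)"
proof -
  have e: "hemi = (\<lambda>x. (x, sqrt (1 - x \<bullet> x)))" by (simp add: fun_eq_iff hemi_def dot_square_norm)
  have pos: "0 < 1 - x \<bullet> x" using snd_hemi_sq[OF assms] snd_hemi_pos[OF assms] by (metis zero_less_power)
  show ?thesis unfolding e
    by (rule has_derivative_eq_rhs, (rule derivative_intros pos)+)
       (use pos in \<open>simp add: fun_eq_iff inner_commute field_simps\<close>)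
qed

text \<open>The differential part of the problem, with D in the role of the chart domain of the
  emitter. Measures and the energy balance are kept outside.\<close>

locale refractor =
  fixes \<kappa> :: real and \<rho> :: "real^'n \<Rightarrow> real" and \<psi> :: "(real^'n) \<times> real \<Rightarrow> real"
    and Z :: "real^'n \<Rightarrow> (real^'n) \<times> real" and D :: "(real^'n) set"
  assumes openD: "open D" and D_ball: "D \<subseteq> ball 0 1"
    and kappa: "0 < \<kappa>" "\<kappa> \<noteq> 1"
    and rho_C2: "Ck_on 2 D \<rho>" and rho_pos: "x \<in> D \<Longrightarrow> 0 < \<rho> x"
    and radicand: "x \<in> D \<Longrightarrow> 0 \<le> snell_radicand \<kappa> \<rho> x"
    and psi_C1: "Ck_on 1 UNIV \<psi>"
    and hits: "x \<in> D \<Longrightarrow> ray_hits {z. \<psi> z = 0} (refr_pt \<rho> x) (refr_dir \<kappa> \<rho> x) (Z x)"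
    and Y_up: "x \<in> D \<Longrightarrow> 0 < snd (refr_dir \<kappa> \<rho> x)"
    and N_up: "x \<in> D \<Longrightarrow> 0 < snd (grad \<psi> (Z x))"
    and transversal: "x \<in> D \<Longrightarrow> 0 < grad \<psi> (Z x) \<bullet> refr_dir \<kappa> \<rho> x"
begin

abbreviation "Y \<equiv> refr_dir \<kappa> \<rho>"
abbreviation "t \<equiv> stretch \<rho> Z"
abbreviation "N x \<equiv> grad \<psi> (Z x)"
abbreviation "p \<equiv> grad \<rho>"

lemma norm_lt: "x \<in> D \<Longrightarrow> norm x < 1"
  using D_ball by auto

lemma YY: "x \<in> D \<Longrightarrow> Y x \<bullet> Y x = 1"
  using norm_refr_dir[of x \<rho>] norm_lt rho_pos radicand kappa by simp

text \<open>Since |Y| = 1, the distance from the refractor to Z is the ray parameter of the first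
  contact.\<close>

lemma Z_eq:
  assumes "x \<in> D"
  shows "Z x = refr_pt \<rho> x + t x *\<^sub>R Y x" "\<psi> (Z x) = 0"
    and "0 \<le> r \<Longrightarrow> r < t x \<Longrightarrow> \<psi> (refr_pt \<rho> x + r *\<^sub>R Y x) \<noteq> 0"
proof -
  obtain s where s: "0 \<le> s" "Z x = refr_pt \<rho> x + s *\<^sub>R Y x" "\<psi> (Z x) = 0"
      "\<And>r. 0 \<le> r \<Longrightarrow> r < s \<Longrightarrow> \<psi> (refr_pt \<rho> x + r *\<^sub>R Y x) \<noteq> 0"
    using hits[OF assms] by (auto simp: ray_hits_def)
  have "norm (Y x) = 1" using YY[OF assms] by (simp add: norm_eq_1)
  then have "t x = s" using s(1,2) by (simp add: stretch_def)
  with s show "Z x = refr_pt \<rho> x + t x *\<^sub>R Y x" "\<psi> (Z x) = 0"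
    "0 \<le> r \<Longrightarrow> r < t x \<Longrightarrow> \<psi> (refr_pt \<rho> x + r *\<^sub>R Y x) \<noteq> 0" by auto
qed

lemmas rho_deriv = Ck_on_2_grad(1)[OF rho_C2]
lemmas p_cont = Ck_on_2_grad(2)[OF rho_C2]
lemmas p_deriv = Ck_on_2_grad(3)[OF rho_C2]
lemmas hess_cont = Ck_on_2_grad(4)[OF rho_C2]
lemmas psi_deriv = Ck_on_1_grad(1)[OF psi_C1, OF UNIV_I]
lemmas N_cont = Ck_on_1_grad(2)[OF psi_C1]

lemma rho_cont: "continuous_on D \<rho>"
  using has_derivative_continuous[OF rho_deriv] by (simp add: continuous_at_imp_continuous_on)

text \<open>The product of Y with the normal is q / sqrt a, so these are the points where the
  refracted ray leaves the refractor transversally.\<close>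

definition "subcritical = {x \<in> D. coef_q \<kappa> \<rho> x \<noteq> 0}"

lemma coef_q_cont: "continuous_on D (coef_q \<kappa> \<rho>)"
  unfolding coef_q_def coef_a_def by (intro continuous_intros rho_cont p_cont)

lemma open_subcritical: "open subcritical"
proof -
  have "subcritical = D \<inter> coef_q \<kappa> \<rho> -` (- {0})" by (auto simp: subcritical_def)
  then show ?thesis using continuous_open_preimage[OF coef_q_cont openD, of "- {0}"]
    by (simp add: open_Compl)
qed

lemma subcritical_D: "x \<in> subcritical \<Longrightarrow> x \<in> D" by (simp add: subcritical_def)

text \<open>The last component of Y is recovered as sqrt (1 - |y|^2) from |Y| = 1 and its positive
  sign, so its derivative is determined by Dy.\<close>

lemma Y_deriv:
  assumes "x \<in> subcritical"
  shows "(Y has_derivative (\<lambda>h. (mat_Dy \<kappa> \<rho> x *v h,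
      - (fst (Y x) \<bullet> (mat_Dy \<kappa> \<rho> x *v h)) / snd (Y x)))) (at x)"
proof -
  have x: "x \<in> D" "coef_q \<kappa> \<rho> x \<noteq> 0" using assms by (auto simp: subcritical_def)
  have dy: "((\<lambda>x. fst (Y x)) has_derivative (\<lambda>h. mat_Dy \<kappa> \<rho> x *v h)) (at x)"
    using x refr_dir_fst_has_derivative[OF rho_deriv p_deriv, of x \<kappa>] norm_lt rho_pos radicand kappa by blast
  have sY: "snd (Y u) = sqrt (1 - fst (Y u) \<bullet> fst (Y u))" if "u \<in> D" for u
  proof -
    have "(snd (Y u))\<^sup>2 = 1 - fst (Y u) \<bullet> fst (Y u)"
      using YY[OF that] by (simp add: inner_prod_def power2_eq_square)
    then show ?thesis using Y_up[OF that] by (metis real_sqrt_unique less_imp_le)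
  qed
  have pos: "0 < 1 - fst (Y x) \<bullet> fst (Y x)"
    using sY[OF x(1)] Y_up[OF x(1)] by (metis real_sqrt_gt_0_iff)
  have "((\<lambda>u. (fst (Y u), sqrt (1 - fst (Y u) \<bullet> fst (Y u)))) has_derivative (\<lambda>h. (mat_Dy \<kappa> \<rho> x *v h,
      - (fst (Y x) \<bullet> (mat_Dy \<kappa> \<rho> x *v h)) / snd (Y x)))) (at x)"
    by (rule has_derivative_eq_rhs, (rule derivative_intros dy pos)+)
       (use pos in \<open>simp add: fun_eq_iff inner_commute field_simps sY[OF x(1)]\<close>)
  then show ?thesis
    by (rule has_derivative_transform_within_open[OF _ openD x(1)]) (simp add: sY[symmetric])
qed

lemma Y_cont: "continuous_on subcritical Y"
  using has_derivative_continuous[OF Y_deriv] by (simp add: continuous_at_imp_continuous_on)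

lemma hemi_cont: "continuous_on D hemi"
  using has_derivative_continuous[OF hemi_has_derivative[OF norm_lt]] by (simp add: continuous_at_imp_continuous_on)

lemma refr_pt_cont: "continuous_on D (refr_pt \<rho>)"
  unfolding refr_pt_def by (intro continuous_intros rho_cont hemi_cont)

definition "regular_pts = {x \<in> subcritical. t x \<noteq> 0}"

lemma regular_pts_subcritical: "x \<in> regular_pts \<Longrightarrow> x \<in> subcritical" by (simp add: regular_pts_def)

lemma t_isCont:
  assumes "x \<in> regular_pts"
  shows "isCont t x"
proof (rule first_hit_isCont[OF open_subcritical, where P = "refr_pt \<rho>" and Y = Y and \<psi> = \<psi> and N = "N x"])
  show "x \<in> subcritical" using assms by (simp add: regular_pts_def)
  then have x: "x \<in> D" by (rule subcritical_D)
  show "continuous_on subcritical (refr_pt \<rho>)" using refr_pt_cont by (rule continuous_on_subset) (auto simp: subcritical_def)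
  show "continuous_on subcritical Y" by (rule Y_cont)
  show "continuous_on UNIV \<psi>"
    using has_derivative_continuous[OF psi_deriv] by (simp add: continuous_at_imp_continuous_on)
  show "0 < t x" using assms by (simp add: regular_pts_def stretch_def)
  show "(\<psi> has_derivative (\<bullet>) (N x)) (at (refr_pt \<rho> x + t x *\<^sub>R Y x))"
    using psi_deriv[of "Z x"] Z_eq(1)[OF x] by simp
  show "0 < N x \<bullet> Y x" by (rule transversal[OF x])
  show "0 \<le> t u \<and> \<psi> (refr_pt \<rho> u + t u *\<^sub>R Y u) = 0" if "u \<in> subcritical" for u
    using Z_eq(1,2)[OF subcritical_D[OF that]] by (simp add: stretch_def)
  show "\<psi> (refr_pt \<rho> u + r *\<^sub>R Y u) \<noteq> 0" if "u \<in> subcritical" "0 \<le> r" "r < t u" for u r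
    using Z_eq(3)[OF subcritical_D[OF that(1)] that(2,3)] .
qed

lemma open_regular_pts: "open regular_pts"
proof (subst open_subopen, safe)
  fix x assume x: "x \<in> regular_pts"
  then have "t x \<noteq> 0" by (simp add: regular_pts_def)
  with t_isCont[OF x] have "\<forall>\<^sub>F u in at x. t u \<noteq> 0"
    by (simp add: isCont_def tendsto_imp_eventually_ne)
  moreover have "\<forall>\<^sub>F u in nhds x. u \<in> subcritical" using open_subcritical regular_pts_subcritical[OF x] by (rule eventually_nhds_in_open)
  ultimately have "\<forall>\<^sub>F u in nhds x. u \<in> regular_pts"
    using \<open>t x \<noteq> 0\<close> unfolding eventually_nhds_conv_at regular_pts_def
    by (auto elim: eventually_elim2)
  then show "\<exists>T. open T \<and> x \<in> T \<and> T \<subseteq> regular_pts" unfolding eventually_nhds by blast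
qed

text \<open>The Jacobian matrix of x \<mapsto> z, where Z = (z, \<open>snd Z\<close>).\<close>

definition mat_Dz :: "real^'n \<Rightarrow> real^'n^'n" where
  "mat_Dz x = t x *\<^sub>R (mat_mu2 \<kappa> \<rho> \<psi> Z x ** mat_Dy \<kappa> \<rho> x) + mat_mu1 \<kappa> \<rho> \<psi> Z x"

lemma Z_deriv:
  assumes x: "x \<in> regular_pts"
  shows "(Z has_derivative (\<lambda>h. (mat_Dz x *v h,
     (- (1 / snd (N x)) *\<^sub>R fst (N x)) \<bullet> (mat_Dz x *v h)))) (at x)"
proof -
  have xG: "x \<in> subcritical" and xD: "x \<in> D" using x regular_pts_subcritical subcritical_D by auto
  let ?X' = "\<lambda>h. (h, - (x \<bullet> h) / snd (hemi x))"
  let ?Y' = "\<lambda>h. (mat_Dy \<kappa> \<rho> x *v h, - (fst (Y x) \<bullet> (mat_Dy \<kappa> \<rho> x *v h)) / snd (Y x))"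
  let ?P' = "\<lambda>h. (p x \<bullet> h) *\<^sub>R hemi x + \<rho> x *\<^sub>R ?X' h"
  \<comment> \<open>The derivative of \<psi> along the refracted ray's endpoint with the stretch t
    frozen; by the implicit equation, Dt = - A / (N.Y).\<close>
  define A where "A = (\<lambda>h. N x \<bullet> (?P' h + t x *\<^sub>R ?Y' h))"
  have dP: "(refr_pt \<rho> has_derivative ?P') (at x)"
  proof -
    have "((\<lambda>x. \<rho> x *\<^sub>R hemi x) has_derivative ?P') (at x)"
      by (rule has_derivative_eq_rhs, (rule derivative_intros rho_deriv[OF xD] hemi_has_derivative[OF norm_lt[OF xD]])+)
         (simp add: fun_eq_iff)
    moreover have "refr_pt \<rho> = (\<lambda>x. \<rho> x *\<^sub>R hemi x)" by (simp add: fun_eq_iff refr_pt_def)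
    ultimately show ?thesis by simp
  qed
  note dY = Y_deriv[OF xG]
  have c: "N x \<bullet> Y x \<noteq> 0" using transversal[OF xD] by simp
  let ?F = "\<lambda>(u, s). \<psi> (refr_pt \<rho> u + s *\<^sub>R Y u)"
  have dF: "(?F has_derivative (\<lambda>(h, k). A h + (N x \<bullet> Y x) * k)) (at (x, t x))"
  proof -
    have P1: "((\<lambda>v. refr_pt \<rho> (fst v)) has_derivative (\<lambda>v. ?P' (fst v))) (at (x, t x))"
      by (rule has_derivative_compose[OF has_derivative_fst[OF has_derivative_ident]]) (subst fst_conv, rule dP)
    have Y1: "((\<lambda>v. Y (fst v)) has_derivative (\<lambda>v. ?Y' (fst v))) (at (x, t x))"
      by (rule has_derivative_compose[OF has_derivative_fst[OF has_derivative_ident]]) (subst fst_conv, rule dY)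
    have "((\<lambda>v. refr_pt \<rho> (fst v) + snd v *\<^sub>R Y (fst v)) has_derivative
        (\<lambda>v. ?P' (fst v) + (t x *\<^sub>R ?Y' (fst v) + snd v *\<^sub>R Y x))) (at (x, t x))"
      by (rule has_derivative_eq_rhs, (rule derivative_intros P1 Y1)+) (simp add: fun_eq_iff)
    then have "((\<lambda>v. \<psi> (refr_pt \<rho> (fst v) + snd v *\<^sub>R Y (fst v))) has_derivative
        (\<lambda>v. N x \<bullet> (?P' (fst v) + (t x *\<^sub>R ?Y' (fst v) + snd v *\<^sub>R Y x)))) (at (x, t x))"
      by (rule has_derivative_compose[where g' = "\<lambda>v. N x \<bullet> v"])
         (use psi_deriv[of "Z x"] Z_eq(1)[OF xD] in simp)
    moreover have "N x \<bullet> (?P' h + (t x *\<^sub>R ?Y' h + k *\<^sub>R Y x)) = A h + (N x \<bullet> Y x) * k" for h k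
      unfolding A_def by (simp only: inner_add_right inner_scaleR_right ac_simps)
    ultimately show ?thesis unfolding case_prod_beta by (simp only:)
  qed
  have blA: "bounded_linear A"
    unfolding A_def
    using has_derivative_bounded_linear[OF has_derivative_add[OF dP has_derivative_scaleR_right[OF dY, of "t x"]]]
    by (rule bounded_linear_compose[OF bounded_linear_inner_right])
  have F0: "?F (u, t u) = 0" if "u \<in> D" for u using Z_eq(1,2)[OF that] by simp
  have dt: "(t has_derivative (\<lambda>h. - A h / (N x \<bullet> Y x))) (at x)"
  proof (rule implicit_has_derivative[OF dF c t_isCont[OF x] blA])
    show "?F (x, t x) = 0" by (rule F0[OF xD])
    have "\<forall>\<^sub>F u in at x. u \<in> D"
      using eventually_nhds_in_open[OF openD xD] by (simp add: eventually_nhds_conv_at)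
    then show "\<forall>\<^sub>F u in at x. ?F (u, t u) = 0" by eventually_elim (rule F0)
  qed
  define L where "L = (\<lambda>h. ?P' h + (t x *\<^sub>R ?Y' h + (- A h / (N x \<bullet> Y x)) *\<^sub>R Y x))"
  have dZ: "(Z has_derivative L) (at x)"
  proof (rule has_derivative_transform_within_open[OF _ openD xD])
    show "((\<lambda>u. refr_pt \<rho> u + t u *\<^sub>R Y u) has_derivative L) (at x)"
      unfolding L_def by (intro derivative_intros dP dY dt)
  qed (simp add: Z_eq(1)[symmetric])
  \<comment> \<open>The derivative of Z is tangent to the receiver. Hence only its first n
    components have to be computed, and the last one follows from the slope of the tangent
    hyperplane.\<close>
  have NL: "N x \<bullet> L h = 0" for h
    using c by (simp add: L_def A_def inner_add_right)
  have fL: "fst (L h) = mat_Dz x *v h" for h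
  proof -
    define m where "m = 1 / (N x \<bullet> Y x)"
    have A: "A h = (N x \<bullet> hemi x) * (p x \<bullet> h)
        + \<rho> x * (fst (N x) \<bullet> h - snd (N x) / snd (hemi x) * (x \<bullet> h))
        + t x * ((fst (N x) - (snd (N x) / snd (Y x)) *\<^sub>R fst (Y x)) \<bullet> (mat_Dy \<kappa> \<rho> x *v h))"
      by (simp add: A_def inner_add_right inner_prod_def[of "N x" "(_, _)"] inner_diff_left algebra_simps)
    have "mat_Dz x *v h = t x *\<^sub>R (mat_Dy \<kappa> \<rho> x *v h) + \<rho> x *\<^sub>R h + (p x \<bullet> h) *\<^sub>R x
        - (m * A h) *\<^sub>R fst (Y x)"
      unfolding A
      by (simp add: mat_Dz_def mat_mu1_def mat_mu2_def Let_def matrix_vector_mult_add_rdistrib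
        matrix_vector_mult_diff_rdistrib scaleR_matrix_vector outer_mult_vec m_def[symmetric]
        flip: matrix_vector_mul_assoc) (simp add: algebra_simps)
    also have "\<dots> = fst (L h)" by (simp add: L_def m_def algebra_simps)
    finally show ?thesis by simp
  qed
  have "L = (\<lambda>h. (mat_Dz x *v h, (- (1 / snd (N x)) *\<^sub>R fst (N x)) \<bullet> (mat_Dz x *v h)))"
    using inner_eq_0_imp_graph[OF NL] N_up[OF xD] by (simp add: fL[symmetric] fun_eq_iff)
  with dZ show ?thesis by simp
qed

end

section \<open>The emitter in the hemisphere chart\<close>

lemma continuous_on_hemi: "continuous_on (ball 0 1) hemi"
  by (intro continuous_at_imp_continuous_on ballI has_derivative_continuous[OF hemi_has_derivative]) simp

lemma hemi_regular_parametrization: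
  "regular_parametrization (sphere 0 1) (ball 0 1) (hemi :: real^'n \<Rightarrow> _)
     (\<lambda>x h. (h, - (1 / snd (hemi x)) *\<^sub>R x \<bullet> h))"
  unfolding regular_parametrization_def
proof (intro conjI ballI allI)
  show "(hemi has_derivative (\<lambda>h. (h, - (1 / snd (hemi x)) *\<^sub>R x \<bullet> h))) (at x)"
    if "x \<in> ball 0 1" for x :: "real^'n"
    using hemi_has_derivative[of x] that by simp
  show "inj_on hemi (ball (0::real^'n) 1)" by (rule inj_on_inverseI[of _ fst]) simp
  show "hemi ` ball (0::real^'n) 1 \<subseteq> sphere 0 1"
  proof (rule image_subsetI)
    fix x :: "real^'n" assume "x \<in> ball 0 1"
    then show "hemi x \<in> sphere 0 1" using hemi_inner_self[of x] by (simp add: norm_eq_1)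
  qed
  show "continuous_on (ball 0 1) (\<lambda>x. (h, - (1 / snd (hemi x)) *\<^sub>R x \<bullet> h))" for h :: "real^'n"
    using snd_hemi_pos by (intro continuous_intros continuous_on_hemi) fastforce
qed (auto simp: inj_def)

lemma area_element_hemi:
  assumes "norm x < 1"
  shows "area_element (\<lambda>h. (h, - (1 / snd (hemi x)) *\<^sub>R x \<bullet> h)) = 1 / snd (hemi x)"
proof -
  let ?c = "snd (hemi x)"
  have c: "0 < ?c" "?c\<^sup>2 = 1 - x \<bullet> x" using assms by (simp_all add: snd_hemi_pos snd_hemi_sq)
  have "area_element (\<lambda>h. (h, - (1 / ?c) *\<^sub>R x \<bullet> h)) = sqrt (1 + (- (1 / ?c) *\<^sub>R x) \<bullet> (- (1 / ?c) *\<^sub>R x))"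
    using area_element_graph[of _ "mat 1" "- (1 / ?c) *\<^sub>R x"] by simp
  also have "1 + (- (1 / ?c) *\<^sub>R x) \<bullet> (- (1 / ?c) *\<^sub>R x) = (1 / ?c)\<^sup>2"
    using c by (simp add: power_divide power2_eq_square field_simps)
  finally show ?thesis using c by simp
qed

text \<open>Over the open unit ball \<open>hemi\<close> always lands in the upper hemisphere, so
  membership in U reduces to the ambient set Q, and openness follows by a preimage.\<close>

lemma chart_dom_eq:
  fixes U :: "((real^'n) \<times> real) set"
  assumes "U = upper_hemisphere \<inter> Q"
  shows "chart_dom U = ball 0 1 \<inter> hemi -` Q"
proof -
  have *: "hemi x \<in> upper_hemisphere" if "norm x < 1" for x :: "real^'n"
    using hemi_inner_self[OF that] snd_hemi_pos[OF that] by (simp add: upper_hemisphere_def norm_eq_1)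
  have "x \<in> chart_dom U \<longleftrightarrow> x \<in> ball 0 1 \<inter> hemi -` Q" for x
    by (cases "norm x < 1") (simp_all add: chart_dom_def assms *)
  then show ?thesis by (rule set_eqI)
qed

lemma open_chart_dom:
  fixes U :: "((real^'n) \<times> real) set"
  assumes "openin (top_of_set upper_hemisphere) U"
  shows "open (chart_dom U)"
proof -
  obtain Q where Q: "open Q" "U = upper_hemisphere \<inter> Q" using assms openin_open by blast
  from continuous_open_preimage[OF continuous_on_hemi _ Q(1)] show ?thesis
    by (simp add: chart_dom_eq[OF Q(2)])
qed

section \<open>Determinants, and the density of energy on the receiver\<close>

context refractor
begin

lemma t_cont: "continuous_on regular_pts t"
  using t_isCont by (simp add: continuous_at_imp_continuous_on)

lemma regular_pts_D: "x \<in> regular_pts \<Longrightarrow> x \<in> D"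
  using regular_pts_subcritical subcritical_D by blast

lemma NZ_cont: "continuous_on regular_pts N"
proof -
  have "continuous_on regular_pts Z"
    using has_derivative_continuous[OF Z_deriv] by (simp add: continuous_at_imp_continuous_on)
  then show ?thesis by (rule continuous_on_compose2[OF N_cont]) simp
qed

lemma mat_Dz_cont: "continuous_on regular_pts mat_Dz"
proof -
  have WD: "regular_pts \<subseteq> D" and WG: "regular_pts \<subseteq> subcritical" using regular_pts_subcritical subcritical_D by auto
  note [continuous_intros] = continuous_on_subset[OF rho_cont WD] continuous_on_subset[OF p_cont WD]
    continuous_on_subset[OF hess_cont WD] continuous_on_subset[OF hemi_cont WD]
    continuous_on_subset[OF coef_q_cont WD] continuous_on_subset[OF Y_cont WG] t_cont NZ_cont
  have a: "coef_a \<rho> x \<noteq> 0" if "x \<in> regular_pts" for x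
    using coef_a_pos[of x \<rho>] norm_lt[of x] rho_pos[of x] regular_pts_D[OF that] by auto
  have ac [continuous_intros]: "continuous_on regular_pts (coef_a \<rho>)"
    unfolding coef_a_def by (intro continuous_intros)
  have bc [continuous_intros]: "continuous_on regular_pts (coef_b \<kappa> \<rho>)"
    unfolding coef_b_alt by (intro continuous_intros) (use a in auto)
  have q: "coef_q \<kappa> \<rho> x \<noteq> 0" if "x \<in> regular_pts" for x using that WG by (auto simp: subcritical_def)
  have k: "\<kappa>\<^sup>2 - 1 \<noteq> 0" using kappa by (simp add: power2_eq_1_iff)
  have [continuous_intros]: "continuous_on regular_pts (coef_alpha \<kappa> \<rho>)" "continuous_on regular_pts (coef_beta \<kappa> \<rho>)"
    unfolding coef_alpha_def coef_beta_def by (intro continuous_intros; use q k in auto)+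
  have "N x \<bullet> Y x \<noteq> 0" "snd (Y x) \<noteq> 0" "snd (hemi x) \<noteq> 0" if "x \<in> regular_pts" for x
    using transversal[of x] Y_up[of x] snd_hemi_pos[of x] norm_lt[of x] regular_pts_D[OF that] by auto
  then show ?thesis
    unfolding mat_Dz_def mat_mu1_def mat_mu2_def Let_def mat_Dy_def mat_M_def
    by (intro continuous_intros) auto
qed

text \<open>The rank one formula together with |y|^2 = 1 - (\<open>snd Y\<close>)^2. The result is
  positive under the sign conditions of the locale, so \<mu>2 is invertible.\<close>

lemma det_mat_mu2:
  assumes "x \<in> D"
  shows "det (mat_mu2 \<kappa> \<rho> \<psi> Z x) = snd (N x) / (snd (Y x) * (N x \<bullet> Y x))"
proof -
  have NY: "N x \<bullet> Y x = fst (N x) \<bullet> fst (Y x) + snd (N x) * snd (Y x)" by (simp add: inner_prod_def)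
  have yy: "fst (Y x) \<bullet> fst (Y x) = 1 - (snd (Y x))\<^sup>2"
    using YY[OF assms] by (simp add: inner_prod_def power2_eq_square)
  define c where "c = N x \<bullet> Y x"
  have c: "c \<noteq> 0" "snd (Y x) \<noteq> 0" using transversal[OF assms] Y_up[OF assms] by (auto simp: c_def)
  have "mat_mu2 \<kappa> \<rho> \<psi> Z x = mat 1 + outer ((- (1 / c)) *\<^sub>R fst (Y x)) (fst (N x) - (snd (N x) / snd (Y x)) *\<^sub>R fst (Y x))"
    by (simp add: mat_mu2_def Let_def outer_def vec_eq_iff c_def)
  then have "det (mat_mu2 \<kappa> \<rho> \<psi> Z x) =
      1 + ((- (1 / c)) *\<^sub>R fst (Y x)) \<bullet> (fst (N x) - (snd (N x) / snd (Y x)) *\<^sub>R fst (Y x))"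
    by (simp only: det_id_plus_outer)
  also have "\<dots> = 1 - (1 / c) * (fst (N x) \<bullet> fst (Y x) - snd (N x) / snd (Y x) * (1 - (snd (Y x))\<^sup>2))"
    by (simp only: inner_diff_right inner_scaleR_left inner_scaleR_right
      inner_commute[of "fst (Y x)" "fst (N x)"] yy)
       (simp only: algebra_simps)
  also have "fst (N x) \<bullet> fst (Y x) = c - snd (N x) * snd (Y x)" by (simp add: c_def NY)
  finally show ?thesis unfolding c_def[symmetric]
    using c by (simp add: field_simps power2_eq_square)
qed

lemma coef_b_nz: "x \<in> D \<Longrightarrow> coef_b \<kappa> \<rho> x \<noteq> 0"
  using coef_b_nonzero[of x \<rho>] norm_lt rho_pos radicand kappa by blast

lemma invertible_mat_M:
  assumes "x \<in> subcritical"
  shows "invertible (mat_M \<kappa> \<rho> x)"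
proof -
  have x: "x \<in> D" "coef_q \<kappa> \<rho> x \<noteq> 0" using assms by (auto simp: subcritical_def)
  show ?thesis
    unfolding invertible_det_nz
    using det_mat_M[OF norm_lt[OF x(1)] rho_pos[OF x(1)] x(2) coef_b_nz[OF x(1)]] kappa x
      coef_b_nz[OF x(1)] snd_hemi_pos[OF norm_lt[OF x(1)]] rho_pos[OF x(1)] Y_up[OF x(1)] by simp
qed

text \<open>Multiplying by M cancels the inverses in A and B, multiplying by \<mu>2 cancels the one
  in \<mu>0, and what remains is Dz / t. The factor in front of det Dz is positive, hence the
  left-hand side has the sign of the Jacobian.\<close>

lemma refractor_lhs_eq:
  assumes x: "x \<in> regular_pts"
  shows "refractor_lhs \<kappa> \<rho> \<psi> Z x = det (mat_Dz x) * (snd (Y x) * (N x \<bullet> Y x) / (snd (N x) * t x ^ CARD('n)))"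
proof -
  let ?M = "mat_M \<kappa> \<rho> x" and ?b = "coef_b \<kappa> \<rho> x" and ?\<mu>0 = "mat_mu0 \<kappa> \<rho> \<psi> Z x"
    and ?\<mu>1 = "mat_mu1 \<kappa> \<rho> \<psi> Z x" and ?\<mu>2 = "mat_mu2 \<kappa> \<rho> \<psi> Z x" and ?Dy = "mat_Dy \<kappa> \<rho> x"
  have xD: "x \<in> D" by (rule regular_pts_D[OF x])
  have b: "?b \<noteq> 0" by (rule coef_b_nz[OF xD])
  have t: "t x \<noteq> 0" using x by (simp add: regular_pts_def)
  have nz: "snd (N x) \<noteq> 0" "snd (Y x) \<noteq> 0" "N x \<bullet> Y x \<noteq> 0"
    using N_up[OF xD] Y_up[OF xD] transversal[OF xD] by auto
  have MM: "?M ** (matrix_inv ?M ** B) = B" for B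
    by (simp only: matrix_mul_assoc matrix_inv_right[OF invertible_mat_M[OF regular_pts_subcritical[OF x]]] matrix_mul_lid)
  define R where "R = (\<kappa> - ?b * (\<rho> x + x \<bullet> p x)) *\<^sub>R mat 1 +
        outer (coef_alpha \<kappa> \<rho> x *\<^sub>R (p x - (\<rho> x + x \<bullet> p x) *\<^sub>R x) - (2 * ?b) *\<^sub>R x) (p x)"
  have R: "mat_B \<kappa> \<rho> x = ?b *\<^sub>R (matrix_inv ?M ** R)" "?Dy = ?M ** hessian \<rho> x + R"
    by (simp_all only: mat_B_def mat_Dy_def R_def)
  have "invertible ?\<mu>2" using det_mat_mu2[OF xD] nz by (simp add: invertible_det_nz)
  then have \<mu>: "?\<mu>2 ** ?\<mu>0 = ?\<mu>1"
    by (simp add: mat_mu0_def matrix_mul_assoc matrix_inv_right)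
  have "?M ** (hessian \<rho> x + (1 / (?b * t x)) *\<^sub>R mat_A \<kappa> \<rho> \<psi> Z x + (1 / ?b) *\<^sub>R mat_B \<kappa> \<rho> x) =
      ?Dy + (1 / t x) *\<^sub>R ?\<mu>0"
    using b by (simp add: mat_A_def R matrix_add_ldistrib matrix_scaleR_matrix MM)
  then have 1: "refractor_lhs \<kappa> \<rho> \<psi> Z x = det (?Dy + (1 / t x) *\<^sub>R ?\<mu>0)"
    unfolding refractor_lhs_def by (metis det_mul)
  have "mat_Dz x = t x *\<^sub>R (?\<mu>2 ** (?Dy + (1 / t x) *\<^sub>R ?\<mu>0))"
    using t by (simp add: mat_Dz_def matrix_add_ldistrib matrix_scaleR_matrix \<mu> scaleR_add_right)
  then have "det (mat_Dz x) = t x ^ CARD('n) * (snd (N x) / (snd (Y x) * (N x \<bullet> Y x))) * refractor_lhs \<kappa> \<rho> \<psi> Z x"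
    by (simp add: det_scaleR det_mul det_mat_mu2[OF xD] 1)
  then show ?thesis using t nz by (simp add: field_simps)
qed

lemma refractor_jacobian_eq:
  assumes x: "x \<in> regular_pts"
  shows "refractor_jacobian Z x = det (mat_Dz x)"
proof -
  have "((\<lambda>u. fst (Z u)) has_derivative (*v) (mat_Dz x)) (at x)"
    using has_derivative_fst[OF Z_deriv[OF x]] by simp
  then have "frechet_derivative (\<lambda>u. fst (Z u)) (at x) = (*v) (mat_Dz x)"
    by (rule frechet_derivative_at[symmetric])
  then show ?thesis by (simp add: refractor_jacobian_def)
qed

text \<open>The tangent hyperplane of the receiver has slope - \<open>fst N\<close> /
  \<open>snd N\<close>, so its graph factor is |N| / \<open>snd N\<close>.\<close>

lemma set_integral_receiver_limit:
  assumes \<tau>: "is_surface_measure {z. \<psi> z = 0} \<tau>" and V: "openin (top_of_set {z. \<psi> z = 0}) V"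
    and g: "continuous_on V g" "set_integrable \<tau> V g" "\<And>z. z \<in> V \<Longrightarrow> 0 \<le> g z"
    and ZV: "\<And>x. x \<in> D \<Longrightarrow> Z x \<in> V" and x: "x \<in> regular_pts"
  shows "((\<lambda>r. (LINT z:Z ` cball x r|\<tau>. g z) / measure lborel (cball x r))
    \<longlongrightarrow> g (Z x) * (\<bar>det (mat_Dz x)\<bar> * (norm (N x) / snd (N x)))) (at_right 0)"
proof -
  have xD: "x \<in> D" by (rule regular_pts_D[OF x])
  have N0: "snd (N x) \<noteq> 0" using N_up[OF xD] by simp
  show ?thesis
  proof (rule level_set_graph_chart[OF psi_deriv N_cont Z_eq(2)[OF xD] N0])
    fix Q B \<phi>
    assume chart: "open Q" "Z x \<in> Q" "fst (Z x) \<in> B" "\<phi> (fst (Z x)) = Z x"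
      "regular_parametrization {z. \<psi> z = 0} B \<phi>
         (\<lambda>u h. (h, - (1 / snd (grad \<psi> (\<phi> u))) *\<^sub>R fst (grad \<psi> (\<phi> u)) \<bullet> h))"
      "\<And>z. z \<in> Q \<Longrightarrow> \<psi> z = 0 \<Longrightarrow> \<phi> (fst z) = z"
    have "isCont Z x" using Z_deriv[OF x] by (rule has_derivative_continuous)
    then have "\<forall>\<^sub>F u in nhds x. Z u \<in> Q"
      using chart(1,2) by (simp add: continuous_within tendsto_nhds_iff topological_tendstoD
          eventually_nhds_conv_at isCont_def)
    moreover have "\<forall>\<^sub>F u in nhds x. u \<in> D" by (rule eventually_nhds_in_open[OF openD xD])
    ultimately have ev: "\<forall>\<^sub>F u in nhds x. \<phi> (fst (Z u)) = Z u"
      by eventually_elim (use chart(6) Z_eq(2) in blast)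
    have ZW: "Z ` regular_pts \<subseteq> V" using ZV regular_pts_D by blast
    have cw: "continuous_on regular_pts (\<lambda>x. - (1 / snd (N x)) *\<^sub>R fst (N x))"
      by (intro continuous_intros NZ_cont) (use N_up regular_pts_D in fastforce)
    have "((\<lambda>r. (LINT z:Z ` cball x r|\<tau>. g z) / measure lborel (cball x r))
      \<longlongrightarrow> g (Z x) * (\<bar>det (mat_Dz x)\<bar> * sqrt (1 + (- (1 / snd (N x)) *\<^sub>R fst (N x)) \<bullet> (- (1 / snd (N x)) *\<^sub>R fst (N x))))) (at_right 0)"
      by (rule set_integral_image_cball_limit[OF \<tau> V g(1,2) _ open_regular_pts x ZW _ mat_Dz_cont cw chart(5,3) ev])
         (fact g(3), fact Z_deriv)
    moreover have "sqrt (1 + (- (1 / snd (N x)) *\<^sub>R fst (N x)) \<bullet> (- (1 / snd (N x)) *\<^sub>R fst (N x))) = norm (N x) / snd (N x)"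
    proof -
      have "1 + (- (1 / snd (N x)) *\<^sub>R fst (N x)) \<bullet> (- (1 / snd (N x)) *\<^sub>R fst (N x)) = (N x \<bullet> N x) / (snd (N x))\<^sup>2"
        using N0 by (simp add: inner_prod_def field_simps power2_eq_square)
      then show ?thesis using N_up[OF xD] by (simp add: real_sqrt_divide norm_eq_sqrt_inner)
    qed
    ultimately show ?thesis by simp
  qed
qed

end

section \<open>The equation of the refractor\<close>

theorem theorem1:
  fixes n1 n2 \<kappa> :: real
    and U V :: "((real^'n) \<times> real) set"
    and \<psi> f g :: "(real^'n) \<times> real \<Rightarrow> real"
    and \<sigma> \<tau> :: "((real^'n) \<times> real) measure"
    and \<rho> :: "real^'n \<Rightarrow> real"
    and Z :: "real^'n \<Rightarrow> (real^'n) \<times> real"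
  assumes "CARD('n) \<ge> 2"
    and "n1 > 0" "n2 > 0" "\<kappa> = n1 / n2" "\<kappa> \<noteq> 1"
    and "openin (top_of_set upper_hemisphere) U"
    and "regular_hypersurface \<psi>"
    and "openin (top_of_set {z. \<psi> z = 0}) V"
    and "is_surface_measure (sphere 0 1) \<sigma>"
    and "is_surface_measure {z. \<psi> z = 0} \<tau>"
    and "smooth_along U f" "\<forall>X\<in>U. f X > 0" "set_integrable \<sigma> U f"
    and "smooth_along V g" "\<forall>z\<in>V. g z > 0" "set_integrable \<tau> V g"
    and "set_lebesgue_integral \<sigma> U f = set_lebesgue_integral \<tau> V g"
    and "Ck_on 2 (chart_dom U) \<rho>" "\<forall>x\<in>chart_dom U. \<rho> x > 0"
    and "\<forall>x\<in>chart_dom U. snell_radicand \<kappa> \<rho> x \<ge> 0"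
    and "\<forall>x\<in>chart_dom U. ray_hits {z. \<psi> z = 0} (refr_pt \<rho> x) (refr_dir \<kappa> \<rho> x) (Z x)"
    and "solves_near_field_refractor U V f g \<sigma> \<tau> Z"
    and "\<forall>x\<in>chart_dom U. snd (refr_dir \<kappa> \<rho> x) > 0"
    and "\<forall>x\<in>chart_dom U. snd (grad \<psi> (Z x)) > 0"
    and "\<forall>x\<in>chart_dom U. grad \<psi> (Z x) \<bullet> refr_dir \<kappa> \<rho> x > 0"
    and "setdist U V > 0"
  shows "(\<forall>x\<in>chart_dom U. coef_q \<kappa> \<rho> x \<noteq> 0 \<and> stretch \<rho> Z x \<noteq> 0 \<longrightarrow>
            \<bar>refractor_lhs \<kappa> \<rho> \<psi> Z x\<bar> = refractor_rhs \<kappa> \<rho> \<psi> Z f g x \<and>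
            (refractor_jacobian Z x > 0 \<longrightarrow>
               refractor_lhs \<kappa> \<rho> \<psi> Z x = refractor_rhs \<kappa> \<rho> \<psi> Z f g x)) \<and>
         (\<exists>e>0. \<forall>x\<in>chart_dom U. norm x < e \<and> coef_q \<kappa> \<rho> x \<noteq> 0 \<longrightarrow>
            invertible (mat_M \<kappa> \<rho> x))"
proof -
  let ?D = "chart_dom U"
  have \<kappa>: "0 < \<kappa>" using assms(2-4) by simp
  have \<psi>1: "Ck_on 1 UNIV \<psi>"
    using assms(7) unfolding regular_hypersurface_def smooth_on_def by blast
  interpret refractor \<kappa> \<rho> \<psi> Z ?D
    using open_chart_dom[OF assms(6)] \<kappa> \<psi>1 assms(5,18-21,23-25)
    by unfold_locales (auto simp: chart_dom_def)
  have ZV: "Z x \<in> V" if "x \<in> ?D" for x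
    using assms(22) that by (simp add: solves_near_field_refractor_def)
  have gpos: "0 \<le> g z" if "z \<in> V" for z using assms(15) that by (simp add: less_imp_le)
  have cf: "continuous_on U f" and cg: "continuous_on V g"
    using assms(11,14) by (auto intro: smooth_along_continuous)
  have main: "\<bar>det (mat_Dz x)\<bar> * (g (Z x) * norm (grad \<psi> (Z x)) * snd (hemi x)) = f (hemi x) * snd (grad \<psi> (Z x))"
    if x: "x \<in> regular_pts" for x
  proof -
    have xD: "x \<in> ?D" by (rule regular_pts_D[OF x])
    then have x1: "norm x < 1" and xU: "hemi x \<in> U" by (auto simp: chart_dom_def)
    have cX: "0 < snd (hemi x)" by (rule snd_hemi_pos[OF x1])
    have sub: "\<forall>\<^sub>F r in at_right 0. cball x r \<subseteq> ?D" by (rule eventually_cball_subset[OF openD xD])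
    have "\<forall>\<^sub>F r in at_right 0. hemi ` cball x r \<subseteq> U"
      using sub by eventually_elim (auto simp: chart_dom_def)
    from set_integral_shrinking_cball[OF assms(9) hemi_regular_parametrization _ _ this xU cf assms(13)]
    have 1: "((\<lambda>r. (LINT X:hemi ` cball x r|\<sigma>. f X) / measure lborel (cball x r))
        \<longlongrightarrow> f (hemi x) * (1 / snd (hemi x))) (at_right 0)"
      using x1 cX by (simp only: area_element_hemi) simp
    have 2: "((\<lambda>r. (LINT z:Z ` cball x r|\<tau>. g z) / measure lborel (cball x r))
      \<longlongrightarrow> g (Z x) * (\<bar>det (mat_Dz x)\<bar> * (norm (grad \<psi> (Z x)) / snd (grad \<psi> (Z x))))) (at_right 0)"
      by (rule set_integral_receiver_limit[OF assms(10,8) cg assms(16) _ _ x]) (fact gpos, fact ZV)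
    have "\<forall>\<^sub>F r in at_right 0. cball x r \<subseteq> regular_pts" by (rule eventually_cball_subset[OF open_regular_pts x])
    then have "\<forall>\<^sub>F r in at_right 0. (LINT X:hemi ` cball x r|\<sigma>. f X) / measure lborel (cball x r) =
        (LINT z:Z ` cball x r|\<tau>. g z) / measure lborel (cball x r)"
    proof eventually_elim
      case (elim r)
      have D: "cball x r \<subseteq> ?D" using elim regular_pts_D by blast
      then have B: "cball x r \<subseteq> ball 0 1" by (auto simp: chart_dom_def)
      have inj: "chart_dom (hemi ` cball x r) = cball x r"
      proof
        show "chart_dom (hemi ` cball x r) \<subseteq> cball x r"
        proof
          fix u assume "u \<in> chart_dom (hemi ` cball x r)"
          then obtain v where "v \<in> cball x r" "hemi u = hemi v" by (auto simp: chart_dom_def)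
          then show "u \<in> cball x r" by (metis fst_hemi)
        qed
        show "cball x r \<subseteq> chart_dom (hemi ` cball x r)" using B by (auto simp: chart_dom_def)
      qed
      have "compact (hemi ` cball x r)"
        by (intro compact_continuous_image continuous_on_subset[OF continuous_on_hemi B]) simp
      then have "hemi ` cball x r \<in> sets borel" by (simp add: borel_compact)
      moreover have "hemi ` cball x r \<subseteq> U" using D by (auto simp: chart_dom_def)
      ultimately have E: "(LINT X:hemi ` cball x r|\<sigma>. f X) = (LINT z:Z ` cball x r|completion \<tau>. g z)"
        using assms(22) unfolding solves_near_field_refractor_def by (metis inj)
      have "continuous_on regular_pts Z"
        using has_derivative_continuous[OF Z_deriv] by (simp add: continuous_at_imp_continuous_on)
      then have cZ: "compact (Z ` cball x r)"
        using elim by (intro compact_continuous_image) (auto intro: continuous_on_subset)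
      have ZrV: "Z ` cball x r \<subseteq> V" using D ZV by blast
      moreover have "V \<subseteq> {z. \<psi> z = 0}" using assms(8) openin_subset by fastforce
      ultimately have Zs: "Z ` cball x r \<in> sets \<tau>"
        using compact_image_in_sets_surface[OF assms(10) cZ] by blast
      have "set_integrable \<tau> (Z ` cball x r) g" by (rule set_integrable_subset[OF assms(16) Zs ZrV])
      then have "(LINT z:Z ` cball x r|completion \<tau>. g z) = (LINT z:Z ` cball x r|\<tau>. g z)"
        unfolding set_lebesgue_integral_def set_integrable_def
        by (intro integral_completion borel_measurable_integrable)
      with E show ?case by simp
    qed
    from tendsto_unique[OF _ 1[THEN tendsto_cong[OF this, THEN iffD1]] 2]
    have "f (hemi x) * (1 / snd (hemi x)) =
        g (Z x) * (\<bar>det (mat_Dz x)\<bar> * (norm (grad \<psi> (Z x)) / snd (grad \<psi> (Z x))))" by simp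
    then show ?thesis using cX N_up[OF xD] by (simp add: field_simps)
  qed
  have eq: "\<bar>refractor_lhs \<kappa> \<rho> \<psi> Z x\<bar> = refractor_rhs \<kappa> \<rho> \<psi> Z f g x \<and>
            (refractor_jacobian Z x > 0 \<longrightarrow>
               refractor_lhs \<kappa> \<rho> \<psi> Z x = refractor_rhs \<kappa> \<rho> \<psi> Z f g x)" if x: "x \<in> regular_pts" for x
  proof -
    have xD: "x \<in> ?D" by (rule regular_pts_D[OF x])
    have x1: "norm x < 1" using xD by (simp add: chart_dom_def)
    define c where "c = snd (refr_dir \<kappa> \<rho> x) * (grad \<psi> (Z x) \<bullet> refr_dir \<kappa> \<rho> x)
        / (snd (grad \<psi> (Z x)) * stretch \<rho> Z x ^ CARD('n))"
    have t: "0 < stretch \<rho> Z x" using x by (simp add: regular_pts_def stretch_def)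
    have N: "0 < snd (grad \<psi> (Z x))" by (rule N_up[OF xD])
    have c: "0 < c" unfolding c_def using N t Y_up[OF xD] transversal[OF xD] by simp
    have lhs: "refractor_lhs \<kappa> \<rho> \<psi> Z x = det (mat_Dz x) * c"
      unfolding c_def by (rule refractor_lhs_eq[OF x])
    have g0: "0 < g (Z x)" using assms(15) ZV[OF xD] by blast
    have NN: "0 < norm (grad \<psi> (Z x))" using N by auto
    have "\<bar>det (mat_Dz x)\<bar> = f (hemi x) * snd (grad \<psi> (Z x)) / (g (Z x) * norm (grad \<psi> (Z x)) * snd (hemi x))"
      using main[OF x] g0 NN snd_hemi_pos[OF x1] by (simp add: field_simps)
    then have rhs: "\<bar>det (mat_Dz x)\<bar> * c = refractor_rhs \<kappa> \<rho> \<psi> Z f g x"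
      unfolding c_def refractor_rhs_def using N by (simp add: field_simps)
    show ?thesis
      using c rhs by (auto simp: lhs abs_mult refractor_jacobian_eq[OF x])
  qed
  show ?thesis
  proof (intro conjI ballI impI)
    fix x assume "x \<in> ?D" "coef_q \<kappa> \<rho> x \<noteq> 0 \<and> stretch \<rho> Z x \<noteq> 0"
    then have "x \<in> regular_pts" by (simp add: regular_pts_def subcritical_def)
    from eq[OF this] show "\<bar>refractor_lhs \<kappa> \<rho> \<psi> Z x\<bar> = refractor_rhs \<kappa> \<rho> \<psi> Z f g x"
      "refractor_jacobian Z x > 0 \<Longrightarrow> refractor_lhs \<kappa> \<rho> \<psi> Z x = refractor_rhs \<kappa> \<rho> \<psi> Z f g x" by auto
  next
    show "\<exists>e>0. \<forall>x\<in>?D. norm x < e \<and> coef_q \<kappa> \<rho> x \<noteq> 0 \<longrightarrow> invertible (mat_M \<kappa> \<rho> x)"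
      using invertible_mat_M by (intro exI[of _ 1]) (auto simp: subcritical_def)
  qed
qed

end
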